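(* Let $v_5(5)$ denote the least integer such that every form of degree $5$ with coefficients in $\mathbb{Q}_5$ in $n > v_5(5)$ variables has a non-trivial zero in $\mathbb{Q}_5^n$. Then $v_5(5) \le 4562911$.
   Context: A zero $\mathbf{x}\in\mathbb{Q}_5^n$ of a form is non-trivial if $\mathbf{x}\neq\mathbf{0}$. *)

theory Defs
  imports
    "HOL-Library.Poly_Mapping"
    "HOL-Computational_Algebra.Primes"
    "HOL-Computational_Algebra.Fraction_Field"
begin

section \<open>The field of 5-adic numbers\<close>

text \<open>
  The ring of 5-adic integers is the inverse limit of the rings of integers modulo \<open>5 ^ n\<close>,
  the residue classes being represented by the integers in \<open>{0..<5 ^ n}\<close>.  The condition
  below also forces \<open>x n\<close> to be reduced, since it is the result of a \<open>mod\<close> by \<open>5 ^ n\<close>.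
\<close>

typedef z5 = "{x :: nat \<Rightarrow> int. \<forall>n. x n = x (Suc n) mod 5 ^ n}"
  morphisms residue Abs_z5
  by (rule exI[of _ "\<lambda>_. 0"]) simp

setup_lifting type_definition_z5

lemma coherent_mod:
  fixes x :: "nat \<Rightarrow> int"
  assumes x: "\<forall>n. x n = x (Suc n) mod 5 ^ n" and "m \<le> n"
  shows "x n mod 5 ^ m = x m"
  using \<open>m \<le> n\<close>
proof (induction n rule: dec_induct)
  case base
  show ?case by (subst (1 2) x[rule_format, of m]) simp
next
  case (step n)
  have "(5::int) ^ m dvd 5 ^ n" using step.hyps by (simp add: le_imp_power_dvd)
  then have "x (Suc n) mod 5 ^ m = (x (Suc n) mod 5 ^ n) mod 5 ^ m"
    by (simp add: mod_mod_cancel)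
  also have "\<dots> = x n mod 5 ^ m" by (simp only: x[rule_format, of n, symmetric])
  finally show ?case using step.IH by simp
qed

lemma residue_mod: "m \<le> n \<Longrightarrow> residue x n mod 5 ^ m = residue x m"
  by (rule coherent_mod[OF residue[unfolded mem_Collect_eq]])

lemma residue_mod_self [simp]: "residue x n mod 5 ^ n = residue x n"
  by (rule residue_mod) simp

lemma z5_eqI: "(\<And>n. residue x n = residue y n) \<Longrightarrow> x = y"
  by (simp add: residue_inject[symmetric] fun_eq_iff)

lemma mod_5_power_Suc: "(a::int) mod 5 ^ Suc n mod 5 ^ n = a mod 5 ^ n"
  by (rule mod_mod_cancel) simp

lemma coherent_cong:
  fixes x :: "nat \<Rightarrow> int"
  assumes "\<And>n. x n = x (Suc n) mod 5 ^ n"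
  shows "x n mod 5 ^ n = x (Suc n) mod 5 ^ n"
  by (subst assms) (rule mod_mod_trivial)

instantiation z5 :: comm_ring_1
begin

lift_definition zero_z5 :: z5 is "\<lambda>_. 0" by simp

lift_definition one_z5 :: z5 is "\<lambda>n. 1 mod 5 ^ n"
  by (rule mod_5_power_Suc[symmetric])

lift_definition plus_z5 :: "z5 \<Rightarrow> z5 \<Rightarrow> z5" is "\<lambda>x y n. (x n + y n) mod 5 ^ n"
  by (subst mod_5_power_Suc, intro mod_add_cong coherent_cong)

lift_definition uminus_z5 :: "z5 \<Rightarrow> z5" is "\<lambda>x n. (- x n) mod 5 ^ n"
  by (subst mod_5_power_Suc, intro mod_minus_cong coherent_cong)

lift_definition minus_z5 :: "z5 \<Rightarrow> z5 \<Rightarrow> z5" is "\<lambda>x y n. (x n - y n) mod 5 ^ n"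
  by (subst mod_5_power_Suc, intro mod_diff_cong coherent_cong)

lift_definition times_z5 :: "z5 \<Rightarrow> z5 \<Rightarrow> z5" is "\<lambda>x y n. (x n * y n) mod 5 ^ n"
  by (subst mod_5_power_Suc, intro mod_mult_cong coherent_cong)

lemmas residue_simps =
  zero_z5.rep_eq one_z5.rep_eq plus_z5.rep_eq uminus_z5.rep_eq minus_z5.rep_eq times_z5.rep_eq

instance
proof
  fix a b c :: z5
  show "a * b * c = a * (b * c)"
    by (rule z5_eqI) (simp add: residue_simps mod_simps mult.assoc)
  show "a * b = b * a"
    by (rule z5_eqI) (simp add: residue_simps mod_simps mult.commute)
  show "1 * a = a"
    by (rule z5_eqI) (simp add: residue_simps mod_simps)
  show "a + b + c = a + (b + c)"
    by (rule z5_eqI) (simp add: residue_simps mod_simps add.assoc)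
  show "a + b = b + a"
    by (rule z5_eqI) (simp add: residue_simps mod_simps add.commute)
  show "0 + a = a"
    by (rule z5_eqI) (simp add: residue_simps mod_simps)
  show "- a + a = 0"
    by (rule z5_eqI) (simp add: residue_simps mod_simps)
  show "a - b = a + - b"
    by (rule z5_eqI) (simp add: residue_simps mod_simps)
  show "(a + b) * c = a * c + b * c"
    by (rule z5_eqI) (simp add: residue_simps mod_simps distrib_right)
  show "(0::z5) \<noteq> 1"
  proof
    assume "(0::z5) = 1"
    then have "residue 0 1 = residue 1 1" by simp
    then show False by (simp add: zero_z5.rep_eq one_z5.rep_eq)
  qed
qed

end

instance z5 :: idom
proof
  fix a b :: z5
  assume "a \<noteq> 0" "b \<noteq> 0"
  then obtain i j where i: "residue a i \<noteq> 0" and j: "residue b j \<noteq> 0"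
    by (auto simp: residue_inject[symmetric] zero_z5.rep_eq fun_eq_iff)
  show "a * b \<noteq> 0"
  proof
    assume "a * b = 0"
    then have "residue (a * b) (i + j) = 0" by (simp add: zero_z5.rep_eq)
    then have "(5::int) ^ (i + j) dvd residue a (i + j) * residue b (i + j)"
      by (simp add: times_z5.rep_eq mod_eq_0_iff_dvd)
    moreover have "prime_elem (5::int)"
      by (rule prime_imp_prime_elem) simp
    ultimately obtain k l where kl: "k + l = i + j"
      "5 ^ k dvd residue a (i + j)" "5 ^ l dvd residue b (i + j)"
      using prime_elem_power_dvd_prod by meson
    consider "i \<le> k" | "j \<le> l" using kl(1) by linarith
    then show False
    proof cases
      case 1
      then have "5 ^ i dvd residue a (i + j)"
        using kl(2) by (meson dvd_trans le_imp_power_dvd)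
      then show False using i residue_mod[of i "i + j" a] by simp
    next
      case 2
      then have "5 ^ j dvd residue b (i + j)"
        using kl(3) by (meson dvd_trans le_imp_power_dvd)
      then show False using j residue_mod[of j "i + j" b] by simp
    qed
  qed
qed

type_synonym q5 = "z5 fract"


section \<open>Forms and their zeros\<close>

text \<open>
  A polynomial over \<open>'a\<close> in variables indexed by \<open>nat\<close> is a finitely supported map from
  monomials to coefficients, a monomial being a finitely supported map from variables to
  exponents.
\<close>

type_synonym 'a mpoly = "(nat \<Rightarrow>\<^sub>0 nat) \<Rightarrow>\<^sub>0 'a"

definition eval_mpoly :: "'a::comm_ring_1 mpoly \<Rightarrow> (nat \<Rightarrow> 'a) \<Rightarrow> 'a" where
  "eval_mpoly F x =
     (\<Sum>m\<in>Poly_Mapping.keys F. Poly_Mapping.lookup F m *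
        (\<Prod>i\<in>Poly_Mapping.keys m. x i ^ Poly_Mapping.lookup m i))"

text \<open>
  The variables of a form in \<open>n\<close> variables are those with index \<open>< n\<close>; they need not all occur.
  The zero polynomial counts as a form of every degree.
\<close>

definition is_form :: "nat \<Rightarrow> nat \<Rightarrow> 'a::comm_ring_1 mpoly \<Rightarrow> bool" where
  "is_form n d F \<longleftrightarrow>
     (\<forall>m\<in>Poly_Mapping.keys F. Poly_Mapping.keys m \<subseteq> {..<n} \<and>
        (\<Sum>i\<in>Poly_Mapping.keys m. Poly_Mapping.lookup m i) = d)"

text \<open>
  A point of \<open>n\<close>-dimensional space is given by the first \<open>n\<close> values of \<open>x\<close>; the remaining
  values do not influence a form in \<open>n\<close> variables.
\<close>

definition has_nontrivial_zero :: "nat \<Rightarrow> 'a::comm_ring_1 mpoly \<Rightarrow> bool" where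
  "has_nontrivial_zero n F \<longleftrightarrow> (\<exists>x. (\<exists>i<n. x i \<noteq> 0) \<and> eval_mpoly F x = 0)"

definition forms_isotropic_above :: "nat \<Rightarrow> nat \<Rightarrow> bool" where
  "forms_isotropic_above d v \<longleftrightarrow>
     (\<forall>n>v. \<forall>F :: q5 mpoly. is_form n d F \<longrightarrow> has_nontrivial_zero n F)"

text \<open>
  No negative integer qualifies, because a form in \<open>0\<close> variables has no non-trivial zero, so
  the least integer may be taken among the natural numbers.  The value is unspecified if no
  \<open>v\<close> satisfies \<open>forms_isotropic_above d v\<close>.
\<close>

definition v5 :: "nat \<Rightarrow> nat" where
  "v5 d = (LEAST v. forms_isotropic_above d v)"

end

theory Submission
  imports Defs "HOL-Computational_Algebra.Polynomial" "HOL-Library.Function_Algebras"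
    "HOL-Combinatorics.Permutations"
begin

text \<open>
  Write a quintic form without non-trivial zeros as \<open>F x = M x x x x x\<close> with \<open>M\<close> symmetric and
  5-linear.  Say that \<open>x\<close> is orthogonal to a set \<open>A\<close> of vectors if \<open>M a b c d x\<close>, \<open>M a b c x x\<close> and
  \<open>M a a x x x\<close> vanish on \<open>A\<close>.  Successively orthogonal vectors \<open>z\<^sub>1, z\<^sub>2, \<dots>\<close> make \<open>F (\<Sum> t\<^sub>i z\<^sub>i)\<close> nearly
  diagonal: besides the fifth powers only terms \<open>t\<^sub>i t\<^sub>j\<^sup>4\<close> and \<open>t\<^sub>i t\<^sub>k t\<^sub>j\<^sup>3\<close> with \<open>i, k < j\<close> survive.
  Hensel's lemma and the absence of zeros force their coefficients to be integral, and mostly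
  divisible by 5, once the values \<open>F z\<^sub>i\<close> are units.  From this one deduces that no vector with
  \<open>v (F u) \<equiv> c + 1\<close> modulo 5 can be followed by five vectors with \<open>v (F z\<^sub>i) \<equiv> c\<close>, each orthogonal
  to all earlier ones; and that four such \<open>z\<^sub>i\<close> produce a vector in the class \<open>c + 1\<close>.  Hence for every
  class \<open>c\<close> there are five vectors such that no vector orthogonal to them lies in the class \<open>c\<close>.

  A vector orthogonal to all \<open>5 \<cdot> 5\<close> of these vectors would have no class at all.  It is a common zero
  of 25 cubic, 375 quadratic and 3125 linear forms, and these have a common zero in more than
  \<open>4562911\<close> variables: diagonalise one form at a time and use that the non-zero 5-adic numbers fall
  into four classes modulo squares and three modulo cubes, \<open>- 1\<close> being both a square and a cube.
\<close>

section \<open>The ring of 5-adic integers\<close>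

lemma residue_nonneg: "0 \<le> residue a n"
  by (metis residue_mod_self pos_mod_sign zero_less_numeral zero_less_power)

lemma residue_of_int: "residue (of_int m) n = m mod 5 ^ n"
proof -
  have nat: "residue (of_nat k) n = int k mod 5 ^ n" for k
    by (induction k) (simp_all add: residue_simps mod_simps)
  show ?thesis
    by (cases m rule: int_cases2) (simp_all add: nat residue_simps mod_simps)
qed

lemma residue_5_power: "residue (5 ^ k) n = 5 ^ k mod 5 ^ n"
  using residue_of_int[of "5 ^ k" n] by simp

lemma z5_power_dvd_iff: "5 ^ k dvd a \<longleftrightarrow> residue a k = 0"
proof
  assume "5 ^ k dvd a"
  then obtain b where "a = 5 ^ k * b" by (rule dvdE)
  then show "residue a k = 0" by (simp add: times_z5.rep_eq residue_5_power)
next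
  assume a: "residue a k = 0"
  \<comment> \<open>The quotient modulo \<open>5 ^ n\<close> is read off from the residue of
    \<open>a\<close> modulo \<open>5 ^ (n + k)\<close>, since dividing by \<open>5 ^ k\<close> costs
    \<open>k\<close> digits.\<close>
  define B where "B n = residue a (n + k) div 5 ^ k" for n
  have pow: "(5::int) ^ (n + k) = 5 ^ k * 5 ^ n" for n by (simp add: power_add)
  have B_Suc: "B n = B (Suc n) mod 5 ^ n" for n
  proof -
    have "residue a (n + k) = residue a (Suc n + k) mod (5 ^ k * 5 ^ n)"
      using residue_mod[of "n + k" "Suc n + k" a] by (simp add: pow[symmetric])
    also have "\<dots> div 5 ^ k = residue a (Suc n + k) div 5 ^ k mod 5 ^ n"
      by (subst zmod_zmult2_eq) auto
    finally show ?thesis by (simp add: B_def)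
  qed
  have B: "residue (Abs_z5 B) = B"
    by (rule Abs_z5_inverse, rule CollectI, rule allI, rule B_Suc)
  have "a = 5 ^ k * Abs_z5 B"
  proof (rule z5_eqI)
    fix n
    have "residue a (n + k) mod 5 ^ k = 0"
      using residue_mod[of k "n + k" a] a by simp
    then have "5 ^ k * B n = residue a (n + k)"
      unfolding B_def by (intro dvd_mult_div_cancel) (simp only: dvd_eq_mod_eq_0)
    moreover have "residue a (n + k) mod 5 ^ n = residue a n" by (rule residue_mod) simp
    ultimately show "residue a n = residue (5 ^ k * Abs_z5 B) n"
      by (simp add: times_z5.rep_eq B residue_5_power mod_simps)
  qed
  then show "5 ^ k dvd a" by simp
qed

lemma z5_dvd_iff: "5 dvd (a::z5) \<longleftrightarrow> residue a 1 = 0"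
  using z5_power_dvd_iff[of 1 a] by simp

lemma z5_eq_0I: "(\<And>n. 5 ^ n dvd a) \<Longrightarrow> a = (0::z5)"
  by (intro z5_eqI) (simp add: z5_power_dvd_iff zero_z5.rep_eq)

lemma z5_dvd_minus_residue: "5 ^ n dvd a - of_int (residue a n)"
  by (simp add: z5_power_dvd_iff minus_z5.rep_eq residue_of_int)

lemma z5_dvd_of_int: "5 dvd (of_int k :: z5) \<longleftrightarrow> 5 dvd k"
  by (simp add: z5_dvd_iff residue_of_int dvd_eq_mod_eq_0)

lemma z5_prime: "5 dvd a * b \<longleftrightarrow> 5 dvd a \<or> 5 dvd (b::z5)"
proof -
  have "5 dvd (residue a 1 * residue b 1) \<longleftrightarrow> 5 dvd residue a 1 \<or> 5 dvd residue b 1"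
    by (rule prime_dvd_mult_iff) simp
  moreover have "residue c 1 = 0 \<longleftrightarrow> 5 dvd residue c 1" for c
    using residue_mod_self[of c 1] by auto
  ultimately show ?thesis
    by (simp add: z5_dvd_iff times_z5.rep_eq dvd_eq_mod_eq_0)
qed

lemma z5_not_dvd_1 [simp]: "\<not> 5 dvd (1::z5)"
  using z5_dvd_of_int[of 1] by simp

text \<open>Consecutive terms agree modulo \<open>5 ^ n\<close>, so the diagonal
  \<open>residue (x n) n\<close> is already coherent and defines the limit.\<close>

lemma z5_complete:
  assumes "\<And>n. (5::z5) ^ n dvd x (Suc n) - x n"
  obtains l where "\<And>n. 5 ^ n dvd x n - l"
proof -
  define r where "r n = residue (x n) n" for n
  have r_Suc: "r n = r (Suc n) mod 5 ^ n" for n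
  proof -
    have "residue (x (Suc n)) n = residue (x n) n"
    proof -
      have "(residue (x (Suc n)) n - residue (x n) n) mod 5 ^ n = 0"
        using assms[of n] by (simp add: z5_power_dvd_iff minus_z5.rep_eq)
      then have "residue (x (Suc n)) n mod 5 ^ n = residue (x n) n mod 5 ^ n"
        by (simp only: mod_eq_dvd_iff dvd_eq_mod_eq_0)
      then show ?thesis by (simp only: residue_mod_self)
    qed
    then show ?thesis using residue_mod[of n "Suc n" "x (Suc n)"] by (simp add: r_def)
  qed
  have "residue (Abs_z5 r) = r"
    by (rule Abs_z5_inverse, rule CollectI, rule allI, rule r_Suc)
  then have "5 ^ n dvd x n - Abs_z5 r" for n
    by (simp add: z5_power_dvd_iff minus_z5.rep_eq r_def)
  then show thesis by (rule that)
qed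

section \<open>Taylor expansion, Hensel's lemma and units\<close>

lemma poly_taylor:
  fixes p :: "'a::idom poly"
  shows "\<exists>r. poly p (x + h) = poly p x + h * poly (pderiv p) x + h ^ 2 * r"
proof (induction p)
  case 0
  show ?case by (intro exI[of _ 0]) simp
next
  case (pCons a p)
  then obtain r where r: "poly p (x + h) = poly p x + h * poly (pderiv p) x + h ^ 2 * r" by blast
  show ?case
    by (intro exI[of _ "x * r + poly (pderiv p) x + h * r"], simp only: poly_pCons r pderiv_pCons poly_add)
      (simp add: algebra_simps power2_eq_square)
qed

lemma poly_diff_dvd:
  fixes p :: "'a::idom poly"
  shows "x - y dvd poly p x - poly p y"
proof -
  obtain r where "poly p (y + (x - y)) =
      poly p y + (x - y) * poly (pderiv p) y + (x - y) ^ 2 * r"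
    using poly_taylor by blast
  then have "poly p x - poly p y = (x - y) * (poly (pderiv p) y + (x - y) * r)"
    by (simp add: algebra_simps power2_eq_square)
  then show ?thesis by simp
qed

lemma z5_fermat:
  assumes "\<not> 5 dvd (d::z5)"
  shows "5 dvd d ^ 4 - 1"
proof -
  let ?r = "residue d 1"
  have "?r \<noteq> 0" using assms by (simp add: z5_dvd_iff)
  moreover have "0 \<le> ?r" "?r < 5"
    using residue_nonneg[of d 1] residue_mod_self[of d 1]
    by (simp, metis power_one_right pos_mod_bound zero_less_numeral)
  ultimately have "?r = 1 \<or> ?r = 2 \<or> ?r = 3 \<or> ?r = 4" by linarith
  then have "5 dvd (of_int ?r :: z5) ^ 4 - 1"
    using z5_dvd_of_int[of "?r ^ 4 - 1"] by auto
  moreover have "5 dvd d - of_int ?r" using z5_dvd_minus_residue[of 1 d] by simp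
  then have "5 dvd d ^ 4 - of_int ?r ^ 4"
    using dvd_trans poly_diff_dvd[of d "of_int ?r" "monom 1 4"] by (simp add: poly_monom)
  ultimately have "5 dvd (d ^ 4 - of_int ?r ^ 4) + (of_int ?r ^ 4 - 1)" by (intro dvd_add)
  then show ?thesis by simp
qed

lemma z5_solve_mod:
  assumes "\<not> 5 dvd (d::z5)"
  obtains h where "5 dvd c + h * d"
proof
  have "c + - c * d ^ 3 * d = - c * (d ^ 4 - 1)" by (simp add: algebra_simps power_numeral_reduce)
  then show "5 dvd c + - c * d ^ 3 * d" using z5_fermat[OF assms] by simp
qed

text \<open>Newton iteration: each step adds a multiple of \<open>5 ^ Suc n\<close> that gains one
  more factor 5 in \<open>poly p x\<close>, while the derivative stays a unit. Completeness turns
  the approximations into a root.\<close>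

lemma hensel:
  fixes p :: "z5 poly"
  assumes x0: "5 dvd poly p x0" and d: "\<not> 5 dvd poly (pderiv p) x0"
  obtains x where "poly p x = 0" "5 dvd x - x0"
proof -
  define P where "P n x \<longleftrightarrow> 5 ^ Suc n dvd poly p x \<and> 5 dvd x - x0" for n x
  define Q where "Q n x y \<longleftrightarrow> 5 ^ n dvd y - x" for n :: nat and x y :: z5
  have "\<exists>f. \<forall>n. P n (f n) \<and> Q n (f n) (f (Suc n))"
  proof (rule dependent_nat_choice)
    show "\<exists>x. P 0 x" using x0 by (intro exI[of _ x0]) (simp add: P_def)
  next
    fix x n assume "P n x"
    then obtain c where c: "poly p x = 5 ^ Suc n * c" and x: "5 dvd x - x0"
      by (auto simp: P_def)
    have "5 dvd poly (pderiv p) x - poly (pderiv p) x0"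
      using x poly_diff_dvd by (rule dvd_trans)
    then have "\<not> 5 dvd poly (pderiv p) x"
      using d by (metis dvd_diff_commute dvd_diff_right_iff)
    then obtain h where "5 dvd c + h * poly (pderiv p) x" by (rule z5_solve_mod)
    then obtain q where q: "c + h * poly (pderiv p) x = 5 * q" by (rule dvdE)
    obtain r where r: "poly p (x + 5 ^ Suc n * h) =
        poly p x + 5 ^ Suc n * h * poly (pderiv p) x + (5 ^ Suc n * h) ^ 2 * r"
      using poly_taylor by blast
    also have "\<dots> = 5 ^ Suc n * (c + h * poly (pderiv p) x) + 5 ^ Suc (Suc n) * (5 ^ n * h ^ 2 * r)"
      by (simp add: c algebra_simps power2_eq_square)
    also have "\<dots> = 5 ^ Suc (Suc n) * (q + 5 ^ n * h ^ 2 * r)"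
      by (simp add: q algebra_simps)
    finally have "5 ^ Suc (Suc n) dvd poly p (x + 5 ^ Suc n * h)" by simp
    moreover have "5 dvd (x - x0) + 5 ^ Suc n * h" using x by (intro dvd_add) simp_all
    ultimately show "\<exists>y. P (Suc n) y \<and> Q n x y"
      unfolding P_def Q_def
      by (intro exI[of _ "x + 5 ^ Suc n * h"]) (simp add: algebra_simps)
  qed
  then obtain f where f: "\<And>n. P n (f n)" "\<And>n. Q n (f n) (f (Suc n))" by blast
  obtain l where l: "\<And>n. 5 ^ n dvd f n - l"
    by (rule z5_complete[of f]) (use f(2) in \<open>auto simp: Q_def\<close>)
  have "poly p l = 0"
  proof (rule z5_eq_0I)
    fix n
    have "5 ^ n dvd poly p (f n) - poly p l" using l poly_diff_dvd by (rule dvd_trans)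
    moreover have "5 ^ n dvd poly p (f n)"
      using f(1)[of n] by (auto simp: P_def intro: dvd_trans[OF le_imp_power_dvd])
    ultimately show "5 ^ n dvd poly p l" by (metis dvd_diff_right_iff)
  qed
  moreover have "5 dvd f 1 - x0" "5 dvd f 1 - l"
    using f(1)[of 1] l[of 1] by (simp_all only: P_def power_one_right)
  then have "5 dvd (f 1 - x0) - (f 1 - l)" by (rule dvd_diff)
  ultimately show thesis by (intro that) simp_all
qed

lemma z5_unit:
  assumes "\<not> 5 dvd (a::z5)"
  obtains b where "a * b = 1" "\<not> 5 dvd b"
proof -
  obtain h where h: "5 dvd - 1 + h * a" using assms by (rule z5_solve_mod)
  obtain x where "poly [:- 1, a:] x = 0"
    by (rule hensel[of "[:- 1, a:]" h]) (use h assms in \<open>simp_all add: pderiv_pCons\<close>)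
  then have x: "a * x = 1" by (simp add: algebra_simps)
  then have "\<not> 5 dvd x" using z5_not_dvd_1 by (metis dvd_mult)
  with x show thesis by (rule that)
qed

lemma z5_decompose:
  assumes "a \<noteq> (0::z5)"
  obtains k w where "a = 5 ^ k * w" "\<not> 5 dvd w"
proof -
  have "\<exists>n. \<not> 5 ^ n dvd a" using assms z5_eq_0I by blast
  then obtain n where n: "\<not> 5 ^ n dvd a" "\<forall>m<n. 5 ^ m dvd a"
    using exists_least_iff[of "\<lambda>n. \<not> 5 ^ n dvd a"] by auto
  then obtain k where k: "n = Suc k" by (cases n) auto
  then obtain w where w: "a = 5 ^ k * w" using n(2) by (auto elim: dvdE)
  show thesis
  proof (rule that[OF w])
    show "\<not> 5 dvd w" using n(1) unfolding k w by (auto simp: dvd_def mult_ac)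
  qed
qed

section \<open>The field of 5-adic numbers\<close>

definition emb :: "z5 \<Rightarrow> q5" where
  "emb a = Fraction_Field.Fract a 1"

lemma emb_simps [simp]:
  "emb 0 = 0" "emb 1 = 1" "emb (a + b) = emb a + emb b" "emb (a * b) = emb a * emb b"
  "emb (- a) = - emb a" "emb (a - b) = emb a - emb b"
  by (simp_all add: emb_def Zero_fract_def One_fract_def)

lemma emb_power [simp]: "emb (a ^ n) = emb a ^ n"
  by (induction n) simp_all

lemma emb_of_nat [simp]: "emb (of_nat n) = of_nat n"
  by (induction n) simp_all

lemma emb_of_int [simp]: "emb (of_int n) = of_int n"
  by (cases n rule: int_cases2) simp_all

lemma emb_numeral [simp]: "emb (numeral n) = numeral n"
  using emb_of_nat[of "numeral n"] by simp

lemma emb_eq_iff [simp]: "emb a = emb b \<longleftrightarrow> a = b"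
  by (simp add: emb_def eq_fract)

lemma emb_eq_0_iff [simp]: "emb a = 0 \<longleftrightarrow> a = 0"
  using emb_eq_iff[of a 0] by (simp del: emb_eq_iff)

lemma q5_of_int_eq_0 [simp]: "(of_int k :: q5) = 0 \<longleftrightarrow> k = 0"
proof
  assume "(of_int k :: q5) = 0"
  then have "emb (of_int k) = emb 0" by (simp del: emb_eq_iff emb_eq_0_iff)
  then have "(of_int k :: z5) = 0" by (simp only: emb_eq_iff)
  then have "k mod 5 ^ n = 0" for n
    using residue_of_int[of k n] by (simp add: zero_z5.rep_eq)
  then have "5 ^ nat \<bar>k\<bar> dvd \<bar>k\<bar>" by (simp add: dvd_eq_mod_eq_0[symmetric])
  moreover have "\<bar>k\<bar> < 5 ^ nat \<bar>k\<bar>"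
    using of_nat_less_two_power[of "nat \<bar>k\<bar>", where ?'a = int]
      power_mono[of 2 "5::int" "nat \<bar>k\<bar>"] by simp
  ultimately show "k = 0"
    using zdvd_imp_le by fastforce
qed simp

lemma q5_numeral_neq_0 [simp]: "(numeral n :: q5) \<noteq> 0"
  using q5_of_int_eq_0[of "numeral n"] by simp

lemma q5_decompose:
  assumes "x \<noteq> (0::q5)"
  obtains k w where "x = 5 powi k * emb w" "\<not> 5 dvd w"
proof -
  obtain a b where x: "x = Fraction_Field.Fract a b" and b: "b \<noteq> 0" by (rule Fraction_Field.Fract_cases)
  then have "a \<noteq> 0" using assms by (auto simp: fract_collapse)
  then obtain i u where a: "a = 5 ^ i * u" "\<not> 5 dvd u" by (rule z5_decompose)
  obtain j v where v: "b = 5 ^ j * v" "\<not> 5 dvd v" using b by (rule z5_decompose)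
  obtain v' where v': "v * v' = 1" "\<not> 5 dvd v'" using v(2) by (rule z5_unit)
  have ev: "emb v * emb v' = 1" using v'(1) by (metis emb_simps(2,4))
  have "x = emb a / emb b" using b by (simp add: x emb_def)
  also have "\<dots> = 5 ^ i * emb u / (5 ^ j * emb v)" by (simp add: a v)
  also have "\<dots> = 5 ^ i * emb u * emb v' / 5 ^ j" 
    by (simp add: divide_inverse inverse_unique[OF ev])
  also have "\<dots> = 5 powi (int i - int j) * emb (u * v')"
    by (simp add: power_int_diff)
  finally have "x = 5 powi (int i - int j) * emb (u * v')" .
  moreover have "\<not> 5 dvd u * v'"
    using a(2) v'(2) by (simp add: z5_prime)
  ultimately show thesis by (rule that)
qed

section \<open>Congruences modulo 5\<close>

lemma pow5_mod5: "(5::int) dvd m ^ 5 - m"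
proof -
  have "m mod 5 = 0 \<or> m mod 5 = 1 \<or> m mod 5 = 2 \<or> m mod 5 = 3 \<or> m mod 5 = 4" by presburger
  then have "m ^ 5 mod 5 = m mod 5"
    by (elim disjE) (simp_all add: power_mod[of m 5 5, symmetric])
  then show ?thesis by (rule mod_eq_dvd_iff[THEN iffD1])
qed

lemma solve_mod5:
  assumes "\<not> (5::int) dvd d"
  obtains m where "5 dvd d * m + c"
proof -
  have "d mod 5 = 1 \<or> d mod 5 = 2 \<or> d mod 5 = 3 \<or> d mod 5 = 4" using assms by presburger
  then have "d ^ 4 mod 5 = 1 mod 5"
    by (elim disjE) (simp_all add: power_mod[of d 5 4, symmetric])
  then have "5 dvd d ^ 4 - 1" by (rule mod_eq_dvd_iff[THEN iffD1])
  then have "5 dvd (d ^ 4 - 1) * - c" by (rule dvd_mult2)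
  then show thesis by (intro that[of "- c * d ^ 3"]) (simp add: algebra_simps power_numeral_reduce)
qed

text \<open>Arbitrary integers stand for the residue classes and integrality is part of the
  relation, so that \<open>cg_intros\<close> computes the residue of an expression by following its
  syntax.\<close>

definition cg :: "q5 \<Rightarrow> int \<Rightarrow> bool" where
  "cg x k \<longleftrightarrow> (\<exists>a. x = emb a \<and> 5 dvd a - of_int k)"

definition integral :: "q5 \<Rightarrow> bool" where
  "integral x \<longleftrightarrow> (\<exists>a. x = emb a)"

lemma cg_emb: "cg (emb a) k \<longleftrightarrow> 5 dvd a - of_int k"
  by (simp add: cg_def)

lemma cg_emb_residue: "cg (emb a) (residue a 1)"
  unfolding cg_emb using z5_dvd_minus_residue[of 1 a] by simp

lemma z5_unit_residue:
  assumes "\<not> 5 dvd a"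
  shows "residue a 1 \<in> {1, 2, 3, 4}"
proof -
  have "residue a 1 \<noteq> 0" using assms by (simp add: z5_dvd_iff)
  moreover have "residue a 1 = residue a 1 mod 5" using residue_mod_self[of a 1] by simp
  then have "0 \<le> residue a 1" "residue a 1 < 5"
    by (metis pos_mod_sign pos_mod_bound zero_less_numeral)+
  ultimately show ?thesis by auto
qed

lemma integral_iff_cg: "integral x \<longleftrightarrow> (\<exists>k. cg x k)"
  using z5_dvd_minus_residue[of 1] by (auto simp: integral_def cg_def)

lemma integral_emb [simp]: "integral (emb a)"
  by (auto simp: integral_def)

lemma cg_imp_integral: "cg x k \<Longrightarrow> integral x"
  by (auto simp: integral_def cg_def)

lemma cg_add: "cg x k \<Longrightarrow> cg y l \<Longrightarrow> cg (x + y) (k + l)"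
  unfolding cg_def
proof (elim exE conjE)
  fix a b assume "x = emb a" "y = emb b" "5 dvd a - of_int k" "5 dvd b - of_int l"
  then show "\<exists>c. x + y = emb c \<and> 5 dvd c - of_int (k + l)"
    using dvd_add[of 5 "a - of_int k" "b - of_int l"]
    by (intro exI[of _ "a + b"]) (simp add: algebra_simps)
qed

lemma cg_mult: "cg x k \<Longrightarrow> cg y l \<Longrightarrow> cg (x * y) (k * l)"
  unfolding cg_def
proof (elim exE conjE)
  fix a b assume ab: "x = emb a" "y = emb b" "5 dvd a - of_int k" "5 dvd b - of_int l"
  have "5 dvd (a - of_int k) * b + of_int k * (b - of_int l)"
    using ab(3,4) by (intro dvd_add) simp_all
  then show "\<exists>c. x * y = emb c \<and> 5 dvd c - of_int (k * l)"
    by (intro exI[of _ "a * b"]) (simp add: ab(1,2) algebra_simps)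
qed

lemma cg_uminus: "cg x k \<Longrightarrow> cg (- x) (- k)"
  unfolding cg_def
proof (elim exE conjE)
  fix a assume "x = emb a" "5 dvd a - of_int k"
  then show "\<exists>c. - x = emb c \<and> 5 dvd c - of_int (- k)"
    using dvd_minus_iff[of 5 "a - of_int k"]
    by (intro exI[of _ "- a"]) (simp add: algebra_simps)
qed

lemma cg_diff: "cg x k \<Longrightarrow> cg y l \<Longrightarrow> cg (x - y) (k - l)"
  using cg_add[of x k "- y" "- l"] cg_uminus[of y l] by simp

lemma cg_of_int: "cg (of_int k) k"
  unfolding cg_def by (intro exI[of _ "of_int k"]) simp

lemma cg_numeral: "cg (numeral n) (numeral n)"
  using cg_of_int[of "numeral n"] by simp

lemma cg_0: "cg 0 0" and cg_1: "cg 1 1"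
  using cg_of_int[of 0] cg_of_int[of 1] by simp_all

lemma cg_power: "cg x k \<Longrightarrow> cg (x ^ n) (k ^ n)"
  by (induction n) (auto intro: cg_1 cg_mult)

lemmas cg_intros = cg_add cg_mult cg_uminus cg_diff cg_of_int cg_numeral cg_0 cg_1 cg_power

lemma cg_dvd: "cg x k \<Longrightarrow> 5 dvd l - k \<Longrightarrow> cg x l"
  unfolding cg_def
proof (elim exE conjE)
  fix a assume a: "x = emb a" "5 dvd a - of_int k" and "5 dvd l - k"
  then have "5 dvd (of_int (l - k) :: z5)" by (simp only: z5_dvd_of_int)
  with a(2) have "5 dvd (a - of_int k) - of_int (l - k)" by (rule dvd_diff)
  with a show "\<exists>a. x = emb a \<and> 5 dvd a - of_int l" by (intro exI[of _ a]) simp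
qed

lemma cg_dvd_0: "cg x k \<Longrightarrow> 5 dvd k \<Longrightarrow> cg x 0"
  by (rule cg_dvd) (simp_all only: diff_0 dvd_minus_iff)

lemma cg_unique: "cg x k \<Longrightarrow> cg x l \<Longrightarrow> 5 dvd k - l"
  unfolding cg_def
proof (elim exE conjE)
  fix a b assume "x = emb a" "x = emb b" and ab: "5 dvd a - of_int k" "5 dvd b - of_int l"
  then have "a = b" by simp
  with ab have "5 dvd (a - of_int l) - (a - of_int k)" using dvd_diff by blast
  then have "5 dvd (of_int (k - l) :: z5)" by simp
  then show "5 dvd k - l" by (simp only: z5_dvd_of_int)
qed

lemma cg_0_iff: "cg x 0 \<longleftrightarrow> (\<exists>y. integral y \<and> x = 5 * y)"
proof
  assume "cg x 0"
  then obtain a where "x = emb a" "5 dvd a" by (auto simp: cg_def)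
  then show "\<exists>y. integral y \<and> x = 5 * y" by (auto elim!: dvdE)
next
  assume "\<exists>y. integral y \<and> x = 5 * y"
  then obtain y k where "x = 5 * y" "cg y k" by (auto simp: integral_iff_cg)
  then have "cg x (5 * k)" by (auto intro: cg_intros)
  then show "cg x 0" by (rule cg_dvd) simp
qed

lemma integral_add: "integral x \<Longrightarrow> integral y \<Longrightarrow> integral (x + y)"
  and integral_mult: "integral x \<Longrightarrow> integral y \<Longrightarrow> integral (x * y)"
  and integral_uminus: "integral x \<Longrightarrow> integral (- x)"
  and integral_diff: "integral x \<Longrightarrow> integral y \<Longrightarrow> integral (x - y)"
  and integral_of_int: "integral (of_int k)"
  and integral_numeral: "integral (numeral n)"
  and integral_0: "integral 0" and integral_1: "integral 1"
  and integral_power: "integral x \<Longrightarrow> integral (x ^ m)"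
  unfolding integral_iff_cg by (blast intro: cg_intros)+

lemmas integral_intros = integral_add integral_mult integral_uminus integral_diff integral_of_int
  integral_numeral integral_0 integral_1 integral_power

lemma not_integral_inverse:
  assumes "\<not> integral x"
  shows "x \<noteq> 0" "cg (inverse x) 0"
proof -
  show "x \<noteq> 0" using assms integral_0 by auto
  then obtain k w where x: "x = 5 powi k * emb w" "\<not> 5 dvd w" by (rule q5_decompose)
  obtain v where v: "w * v = 1" using x(2) by (rule z5_unit)
  have ev: "emb w * emb v = 1" using v by (metis emb_simps(2,4))
  have "k < 0"
  proof (rule ccontr)
    assume "\<not> k < 0"
    then have "x = emb (5 ^ nat k * w)" by (simp add: x power_int_def)
    then show False using assms integral_emb by metis
  qed
  then obtain n where n: "k = - int (Suc n)" by (metis zero_le_imp_eq_int neg_less_0_iff_less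
    minus_minus less_imp_Suc_add zero_less_imp_eq_int gr0_conv_Suc)
  have "inverse x = 5 * emb (5 ^ n * v)"
    unfolding x n power_int_minus power_int_of_nat inverse_mult_distrib inverse_inverse_eq
      inverse_unique[OF ev] by simp
  then show "cg (inverse x) 0" unfolding cg_0_iff using integral_emb by blast
qed

text \<open>The leading term contributes \<open>5 * c5 * m ^ 4\<close> to the derivative, which
  vanishes modulo 5; so whether a root modulo 5 is simple depends on \<open>c1\<close> to
  \<open>c4\<close> only.\<close>

lemma hensel_quintic:
  fixes m :: int
  assumes c: "integral c0" "integral c1" "integral c2" "integral c3" "integral c4" "integral c5"
    and z: "cg (c0 + c1 * of_int m + c2 * of_int m ^ 2 + c3 * of_int m ^ 3 +
      c4 * of_int m ^ 4 + c5 * of_int m ^ 5) 0"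
    and d: "cg (c1 + 2 * c2 * of_int m + 3 * c3 * of_int m ^ 2 + 4 * c4 * of_int m ^ 3) d"
      "\<not> 5 dvd d"
  obtains x where "c0 + c1 * x + c2 * x ^ 2 + c3 * x ^ 3 + c4 * x ^ 4 + c5 * x ^ 5 = 0"
proof -
  obtain a0 a1 a2 a3 a4 a5 where a: "c0 = emb a0" "c1 = emb a1" "c2 = emb a2" "c3 = emb a3"
    "c4 = emb a4" "c5 = emb a5"
    using c by (auto simp: integral_def)
  define p where "p = [:a0, a1, a2, a3, a4, a5:]"
  have p: "poly p x = a0 + a1 * x + a2 * x ^ 2 + a3 * x ^ 3 + a4 * x ^ 4 + a5 * x ^ 5" for x
    by (simp add: p_def algebra_simps power_numeral_reduce)
  have p': "poly (pderiv p) x =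
      a1 + 2 * a2 * x + 3 * a3 * x ^ 2 + 4 * a4 * x ^ 3 + 5 * (a5 * x ^ 4)" for x
    by (simp add: p_def pderiv_pCons algebra_simps power_numeral_reduce)
  have "emb (poly p (of_int m)) = c0 + c1 * of_int m + c2 * of_int m ^ 2 + c3 * of_int m ^ 3 +
      c4 * of_int m ^ 4 + c5 * of_int m ^ 5"
    by (simp add: p a)
  with z have 1: "5 dvd poly p (of_int m)" by (metis cg_emb of_int_0 diff_zero)
  have "emb (poly (pderiv p) (of_int m) - 5 * (a5 * of_int m ^ 4)) =
      c1 + 2 * c2 * of_int m + 3 * c3 * of_int m ^ 2 + 4 * c4 * of_int m ^ 3"
    by (simp add: p' a)
  with d(1) have "5 dvd (poly (pderiv p) (of_int m) - 5 * (a5 * of_int m ^ 4)) - of_int d"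
    by (metis cg_emb)
  then have 2: "5 dvd (poly (pderiv p) (of_int m) - of_int d) - 5 * (a5 * of_int m ^ 4)"
    by (simp add: algebra_simps)
  have "\<not> 5 dvd poly (pderiv p) (of_int m)"
  proof
    assume "5 dvd poly (pderiv p) (of_int m)"
    then have "5 dvd poly (pderiv p) (of_int m) - 5 * (a5 * of_int m ^ 4) -
        (poly (pderiv p) (of_int m) - of_int d - 5 * (a5 * of_int m ^ 4))"
      by (intro dvd_diff[OF _ 2] dvd_diff[of 5 "poly (pderiv p) (of_int m)"]) simp_all
    then show False using d(2) by (simp add: z5_dvd_of_int)
  qed
  then obtain x where "poly p x = 0" using hensel 1 by blast
  then have "emb (poly p x) = 0" by simp
  then show thesis by (intro that[of "emb x"]) (simp add: p a)
qed

text \<open>The substitution \<open>x = y / D\<close> gives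
  \<open>a / D ^ 5 * y ^ 5 + y + R = 0\<close>, which modulo 5 is linear with the simple root
  \<open>- R\<close>.\<close>

lemma root_dominant_linear:
  assumes "D \<noteq> 0" "cg (a / D ^ 5) 0" "integral R"
  obtains x where "a * x ^ 5 + D * x + R = 0"
proof -
  obtain r where r: "cg R r" using assms(3) by (auto simp: integral_iff_cg)
  obtain x where x: "R + 1 * x + 0 * x ^ 2 + 0 * x ^ 3 + 0 * x ^ 4 + a / D ^ 5 * x ^ 5 = 0"
  proof (rule hensel_quintic[of R 1 0 0 0 "a / D ^ 5" "- r" 1])
    have "cg (R + of_int (- r) + a / D ^ 5 * of_int (- r) ^ 5) (r + - r + 0 * (- r) ^ 5)"
      by (intro cg_intros r assms)
    then show "cg (R + 1 * of_int (- r) + 0 * of_int (- r) ^ 2 + 0 * of_int (- r) ^ 3 +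
        0 * of_int (- r) ^ 4 + a / D ^ 5 * of_int (- r) ^ 5) 0" by simp
  qed (use assms cg_imp_integral cg_1 in \<open>auto intro: integral_intros\<close>)
  show thesis
    by (rule that[of "x / D"]) (use x assms(1) in \<open>simp add: power_divide algebra_simps\<close>)
qed

text \<open>As \<open>m ^ 5\<close> is congruent to \<open>m\<close>, the equation modulo 5 is
  linear with slope \<open>\<alpha> + \<delta>\<close>, whereas the derivative is
  \<open>\<delta>\<close>. If both are units, a root modulo 5 exists and is simple.\<close>

lemma root_unit_linear:
  assumes "cg a \<alpha>" "cg D \<delta>" "\<not> 5 dvd \<delta>" "\<not> 5 dvd \<alpha> + \<delta>" "integral R"
  obtains x where "a * x ^ 5 + D * x + R = 0"
proof -
  obtain r where r: "cg R r" using assms(5) by (auto simp: integral_iff_cg)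
  obtain m where m: "5 dvd (\<alpha> + \<delta>) * m + r" using assms(4) by (rule solve_mod5)
  obtain x where x: "R + D * x + 0 * x ^ 2 + 0 * x ^ 3 + 0 * x ^ 4 + a * x ^ 5 = 0"
  proof (rule hensel_quintic[of R D 0 0 0 a m \<delta>])
    have 1: "cg (R + D * of_int m + a * of_int m ^ 5) (r + \<delta> * m + \<alpha> * m ^ 5)"
      by (intro cg_intros r assms)
    have "5 dvd \<alpha> * (m ^ 5 - m) + ((\<alpha> + \<delta>) * m + r)"
      using pow5_mod5[of m] m by (intro dvd_add[OF dvd_mult[of 5 "m ^ 5 - m"]])
    then have "5 dvd r + \<delta> * m + \<alpha> * m ^ 5" by (simp add: algebra_simps)
    with 1 have "cg (R + D * of_int m + a * of_int m ^ 5) 0" by (rule cg_dvd_0)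
    then show "cg (R + D * of_int m + 0 * of_int m ^ 2 + 0 * of_int m ^ 3 +
        0 * of_int m ^ 4 + a * of_int m ^ 5) 0" by simp
  qed (use assms cg_imp_integral in \<open>auto intro: integral_intros\<close>)
  show thesis by (rule that[of x]) (use x in \<open>simp add: algebra_simps\<close>)
qed

lemma q5_same_square_class:
  fixes f :: "nat \<Rightarrow> q5"
  assumes "\<And>i. i < 5 \<Longrightarrow> f i \<noteq> 0"
  obtains i j s where "i < j" "j < 5" "s ^ 2 * f i + f j = 0"
proof -
  have "\<forall>i. \<exists>k w. i < 5 \<longrightarrow> f i = 5 powi k * emb w \<and> \<not> 5 dvd w"
    using assms q5_decompose by metis
  then obtain k w where kw: "\<And>i. i < 5 \<Longrightarrow> f i = 5 powi (k i) * emb (w i)"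
    "\<And>i. i < 5 \<Longrightarrow> \<not> 5 dvd w i"
    by metis
  define r where "r i = residue (w i) 1" for i
  have r: "r i \<in> {1, 2, 3, 4}" if "i < 5" for i
    unfolding r_def using z5_unit_residue[OF kw(2)[OF that]] .
  \<comment> \<open>Parity of the valuation and quadratic character of the unit part, 1 and 4 being
    the squares modulo 5. Four keys for five values force a coincidence.\<close>
  define key where "key i = (even (k i), r i \<in> {1, 4})" for i
  have "\<not> inj_on key {..<5}"
  proof
    assume "inj_on key {..<5}"
    then have "card (key ` {..<5}) = 5" by (simp add: card_image)
    moreover have "card (key ` {..<5}) \<le> card (UNIV :: (bool \<times> bool) set)"
      by (rule card_mono) simp_all
    moreover have "card (UNIV :: (bool \<times> bool) set) = 4" by (simp add: card_cartesian_product card_UNIV_bool flip: UNIV_Times_UNIV)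
    ultimately show False by simp
  qed
  then obtain i j where ij: "i < j" "j < 5" "key i = key j"
    unfolding inj_on_def by (metis lessThan_iff linorder_neqE_nat)
  from ij have "even (k j - k i)" by (auto simp: key_def)
  then obtain e where e: "k j - k i = 2 * e" by (rule evenE)
  \<comment> \<open>Residues of the same quadratic character agree up to sign, and modulo 5 the
    squares of 1 and 2 are 1 and - 1.\<close>
  have "\<exists>m \<in> {1, 2}. 5 dvd r j + r i * m ^ 2"
    using r[of i] r[of j] ij by (auto simp: key_def)
  then obtain m where m: "m \<in> {1, 2}" "5 dvd r j + r i * m ^ 2" by blast
  obtain t where "poly [:w j, 0, w i:] t = 0"
  proof (rule hensel[of "[:w j, 0, w i:]" "of_int m"])
    have "cg (emb (w j) + emb (w i) * of_int m ^ 2) (r j + r i * m ^ 2)"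
      unfolding r_def by (intro cg_intros cg_emb_residue)
    then have "cg (emb (w j + w i * of_int m ^ 2)) (r j + r i * m ^ 2)" by simp
    then have "cg (emb (w j + w i * of_int m ^ 2)) 0"
      using m(2) by (rule cg_dvd_0)
    then show "5 dvd poly [:w j, 0, w i:] (of_int m)"
      by (simp only: cg_emb) (simp add: algebra_simps power2_eq_square)
    have "\<not> 5 dvd (of_int (2 * m) :: z5)" using m(1) by (subst z5_dvd_of_int) auto
    then show "\<not> 5 dvd poly (pderiv [:w j, 0, w i:]) (of_int m)"
      using kw(2)[of i] ij by (simp add: pderiv_pCons z5_prime)
  qed
  then have "emb (w j + w i * t ^ 2) = 0" by (simp add: power2_eq_square algebra_simps del: emb_simps)
  then have t: "emb (w j) + emb (w i) * emb t ^ 2 = 0" by simp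
  have "(5 powi e * emb t) ^ 2 * f i + f j =
      5 powi (k i + 2 * e) * (emb (w i) * emb t ^ 2) + 5 powi (k j) * emb (w j)"
    using ij by (simp add: kw(1) power_int_add power_int_mult power_mult_distrib mult_ac
      power_int_mult[of 5 2 e, simplified mult.commute])
  also have "k i + 2 * e = k j" using e by simp
  also have "5 powi (k j) * (emb (w i) * emb t ^ 2) + 5 powi (k j) * emb (w j) = 0"
    using t by (simp flip: distrib_left add: add.commute)
  finally show thesis using ij by (intro that)
qed

text \<open>Cubing permutes the non-zero residues modulo 5 and 3 is a unit, so every unit is a cube.
  The valuation modulo 3 alone decides the class, and two of four values share it.\<close>

lemma q5_same_cube_class:
  fixes f :: "nat \<Rightarrow> q5"
  assumes "\<And>i. i < 4 \<Longrightarrow> f i \<noteq> 0"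
  obtains i j s where "i < j" "j < 4" "s ^ 3 * f i + f j = 0"
proof -
  have "\<forall>i. \<exists>k w. i < 4 \<longrightarrow> f i = 5 powi k * emb w \<and> \<not> 5 dvd w"
    using assms q5_decompose by metis
  then obtain k w where kw: "\<And>i. i < 4 \<Longrightarrow> f i = 5 powi (k i) * emb (w i)"
    "\<And>i. i < 4 \<Longrightarrow> \<not> 5 dvd w i"
    by metis
  define r where "r i = residue (w i) 1" for i
  have r: "r i \<in> {1, 2, 3, 4}" if "i < 4" for i
    unfolding r_def using z5_unit_residue[OF kw(2)[OF that]] .
  have "\<not> inj_on (\<lambda>i. k i mod 3) {..<4}"
  proof
    assume "inj_on (\<lambda>i. k i mod 3) {..<4}"
    then have "card ((\<lambda>i. k i mod 3) ` {..<4}) = 4" by (simp add: card_image)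
    moreover have "card ((\<lambda>i. k i mod 3) ` {..<4}) \<le> card {0..<3::int}"
      by (rule card_mono) auto
    ultimately show False by simp
  qed
  then obtain i j where ij: "i < j" "j < 4" "k j mod 3 = k i mod 3"
    unfolding inj_on_def by (metis lessThan_iff linorder_neqE_nat)
  from ij(3) have "3 dvd k j - k i" by (simp add: mod_eq_dvd_iff)
  then obtain e where e: "k j - k i = 3 * e" by (rule dvdE)
  have "\<exists>m \<in> {1, 2, 3, 4}. 5 dvd r j + r i * m ^ 3"
    using r[of i] r[of j] ij by auto
  then obtain m where m: "m \<in> {1, 2, 3, 4}" "5 dvd r j + r i * m ^ 3" by blast
  obtain t where "poly [:w j, 0, 0, w i:] t = 0"
  proof (rule hensel[of "[:w j, 0, 0, w i:]" "of_int m"])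
    have "cg (emb (w j) + emb (w i) * of_int m ^ 3) (r j + r i * m ^ 3)"
      unfolding r_def by (intro cg_intros cg_emb_residue)
    then have "cg (emb (w j + w i * of_int m ^ 3)) (r j + r i * m ^ 3)" by simp
    then have "cg (emb (w j + w i * of_int m ^ 3)) 0"
      using m(2) by (rule cg_dvd_0)
    then show "5 dvd poly [:w j, 0, 0, w i:] (of_int m)"
      by (simp only: cg_emb) (simp add: algebra_simps power3_eq_cube)
    have "\<not> 5 dvd (of_int (3 * m ^ 2) :: z5)" using m(1) by (subst z5_dvd_of_int) auto
    then show "\<not> 5 dvd poly (pderiv [:w j, 0, 0, w i:]) (of_int m)"
      using kw(2)[of i] ij by (simp add: pderiv_pCons z5_prime power2_eq_square)
  qed
  then have "emb (w j + w i * t ^ 3) = 0" by (simp add: power3_eq_cube algebra_simps del: emb_simps)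
  then have t: "emb (w j) + emb (w i) * emb t ^ 3 = 0" by simp
  have "(5 powi e * emb t) ^ 3 * f i + f j =
      5 powi (k i + 3 * e) * (emb (w i) * emb t ^ 3) + 5 powi (k j) * emb (w j)"
    using ij by (simp add: kw(1) power_int_add power_int_mult power_mult_distrib mult_ac
      power_int_mult[of 5 3 e, simplified mult.commute])
  also have "k i + 3 * e = k j" using e by simp
  also have "5 powi (k j) * (emb (w i) * emb t ^ 3) + 5 powi (k j) * emb (w j) = 0"
    using t by (simp flip: distrib_left add: add.commute)
  finally show thesis using ij by (intro that)
qed

text \<open>If \<open>m\<close> inverts the residue of \<open>w\<close>, so does
  \<open>m ^ 5\<close>, which is congruent to \<open>m\<close>.\<close>

lemma q5_normalise_unit:
  assumes "\<not> 5 dvd w"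
  obtains m where "m \<noteq> 0" "cg (of_int m ^ 5 * emb w) 1"
proof -
  let ?r = "residue w 1"
  have "\<not> 5 dvd ?r" using z5_unit_residue[OF assms] by auto
  then obtain m where m: "5 dvd ?r * m + - 1" by (rule solve_mod5)
  have "m \<noteq> 0" using m by auto
  have "5 dvd ?r * (m ^ 5 - m) + (?r * m + - 1)"
    by (rule dvd_add[OF dvd_mult[OF pow5_mod5] m])
  also have "?r * (m ^ 5 - m) + (?r * m + - 1) = m ^ 5 * ?r - 1" by (simp add: algebra_simps)
  finally have "5 dvd m ^ 5 * ?r - 1" .
  then have "5 dvd 1 - m ^ 5 * ?r" by (rule dvd_diff_commute[THEN iffD1])
  with _ have "cg (of_int m ^ 5 * emb w) 1"
    by (rule cg_dvd) (intro cg_intros cg_emb_residue)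
  with \<open>m \<noteq> 0\<close> show thesis by (rule that)
qed

text \<open>Scaling a vector by \<open>l\<close> multiplies a quintic form by \<open>l ^ 5\<close>.
  Up to such scaling, what remains of a non-zero value for the later arguments is its class
  \<open>c\<close>, the valuation modulo 5.\<close>

lemma q5_normalise:
  assumes "x \<noteq> (0::q5)"
  obtains c y l where "c < 5" "cg y 1" "l \<noteq> 0" "l ^ 5 * x = 5 ^ c * y"
proof -
  obtain k w where x: "x = 5 powi k * emb w" "\<not> 5 dvd w"
    using assms by (rule q5_decompose)
  obtain m where m: "m \<noteq> 0" "cg (of_int m ^ 5 * emb w) 1" using x(2) by (rule q5_normalise_unit)
  define q where "q = k div 5"
  define c where "c = nat (k mod 5)"
  have k: "k = 5 * q + int c" by (simp add: q_def c_def)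
  have "(5 powi (- q) :: q5) ^ 5 = 5 powi (- q * 5)"
    by (simp only: power_int_mult power_int_numeral)
  then have "(of_int m * 5 powi (- q)) ^ 5 * x =
      5 powi (- q * 5 + k) * (of_int m ^ 5 * emb w)"
    unfolding x power_mult_distrib by (subst power_int_add) (simp_all only: mult_ac, simp)
  also have "- q * 5 + k = int c" by (simp add: k)
  also have "(5 :: q5) powi int c = 5 ^ c" by (rule power_int_of_nat)
  finally show thesis
    using m by (intro that[of c "of_int m ^ 5 * emb w" "of_int m * 5 powi (- q)"])
      (simp_all, simp add: c_def)
qed

section \<open>Systems of linear, quadratic and cubic forms\<close>

text \<open>Gaussian elimination: the last equation is solved for a pivot unknown \<open>p\<close>
  and substituted into the others, leaving one equation and one unknown fewer.\<close>

lemma homogeneous_system: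
  fixes a :: "nat \<Rightarrow> 'b \<Rightarrow> 'k::field"
  assumes "finite J" "l < card J"
  shows "\<exists>c. (\<exists>j\<in>J. c j \<noteq> 0) \<and> (\<forall>i<l. (\<Sum>j\<in>J. c j * a i j) = 0)"
  using assms
proof (induction l arbitrary: J a)
  case 0
  then have "J \<noteq> {}" by auto
  then show ?case by (intro exI[of _ "\<lambda>_. 1"]) auto
next
  case (Suc l)
  show ?case
  proof (cases "\<forall>j\<in>J. a l j = 0")
    case True
    obtain c where "\<exists>j\<in>J. c j \<noteq> 0" "\<forall>i<l. (\<Sum>j\<in>J. c j * a i j) = 0"
      using Suc.IH[of J a] Suc.prems by auto
    with True show ?thesis by (auto simp: less_Suc_eq)
  next
    case False
    then obtain p where p: "p \<in> J" "a l p \<noteq> 0" by blast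
    let ?J = "J - {p}"
    have "l < card ?J" using Suc.prems p by simp
    then obtain c where c: "\<exists>j\<in>?J. c j \<noteq> 0"
      "\<forall>i<l. (\<Sum>j\<in>?J. c j * (a i j - a l j / a l p * a i p)) = 0"
      using Suc.IH[of ?J "\<lambda>i j. a i j - a l j / a l p * a i p"] Suc.prems by auto
    define d where "d = - (\<Sum>j\<in>?J. c j * a l j) / a l p"
    have sum: "(\<Sum>j\<in>J. (c(p := d)) j * a i j) =
        (\<Sum>j\<in>?J. c j * (a i j - a l j / a l p * a i p))" for i
    proof -
      have "(\<Sum>j\<in>J. (c(p := d)) j * a i j) = d * a i p + (\<Sum>j\<in>?J. c j * a i j)"
        using Suc.prems p by (simp add: sum.remove[of J p])
      also have "d * a i p = - (\<Sum>j\<in>?J. c j * (a l j / a l p * a i p))"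
        by (simp add: d_def sum_divide_distrib sum_distrib_left sum_distrib_right sum_negf mult_ac)
      finally show ?thesis by (simp add: algebra_simps sum_subtractf)
    qed
    have "(\<Sum>j\<in>J. (c(p := d)) j * a l j) = 0"
      unfolding sum using p by simp
    moreover have "\<exists>j\<in>J. (c(p := d)) j \<noteq> 0" using c(1) by auto
    ultimately show ?thesis
      using c(2) by (intro exI[of _ "c(p := d)"]) (auto simp only: less_Suc_eq sum)
  qed
qed

type_synonym vec = "nat \<Rightarrow> q5"

definition smul :: "q5 \<Rightarrow> vec \<Rightarrow> vec" where
  "smul c x = (\<lambda>i. c * x i)"

lemma smul_apply [simp]: "smul c x i = c * x i"
  by (simp add: smul_def)

definition nonzero_in :: "nat \<Rightarrow> vec \<Rightarrow> bool" where
  "nonzero_in n x \<longleftrightarrow> (\<exists>i<n. x i \<noteq> 0)"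

definition linear_form :: "(vec \<Rightarrow> q5) \<Rightarrow> bool" where
  "linear_form f \<longleftrightarrow> (\<forall>x y. f (x + y) = f x + f y) \<and> (\<forall>c x. f (smul c x) = c * f x)"

definition bilinear_form :: "(vec \<Rightarrow> vec \<Rightarrow> q5) \<Rightarrow> bool" where
  "bilinear_form B \<longleftrightarrow> (\<forall>y. linear_form (\<lambda>x. B x y)) \<and> (\<forall>x y. B x y = B y x)"

definition trilinear_form :: "(vec \<Rightarrow> vec \<Rightarrow> vec \<Rightarrow> q5) \<Rightarrow> bool" where
  "trilinear_form C \<longleftrightarrow> (\<forall>y z. linear_form (\<lambda>x. C x y z)) \<and>
     (\<forall>x y z. C x y z = C y x z) \<and> (\<forall>x y z. C x y z = C x z y)"

lemma linear_formD:
  assumes "linear_form f"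
  shows "f (x + y) = f x + f y" "f (smul c x) = c * f x"
  using assms by (auto simp: linear_form_def)

lemma linear_form_coordinate: "linear_form (\<lambda>x. x i)"
  by (simp add: linear_form_def)

lemma bilinear_formD:
  assumes "bilinear_form B"
  shows "linear_form (\<lambda>x. B x y)" "linear_form (B y)"
proof -
  show 1: "linear_form (\<lambda>x. B x y)" using assms by (auto simp: bilinear_form_def)
  have "B y = (\<lambda>x. B x y)" using assms by (auto simp: bilinear_form_def)
  with 1 show "linear_form (B y)" by simp
qed

lemma trilinear_formD:
  assumes "trilinear_form C"
  shows "bilinear_form (C x)" "linear_form (C x y)"
proof -
  have sym: "C u v w = C v u w" "C u v w = C u w v" for u v w
    using assms unfolding trilinear_form_def by blast+
  have lin: "linear_form (\<lambda>x. C x y z)" for y z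
    using assms unfolding trilinear_form_def by blast
  have "linear_form (\<lambda>u. C x u v)" for v
    using lin[of x v] sym(1)[of _ x v] by simp
  then show "bilinear_form (C x)"
    unfolding bilinear_form_def using sym(2) by blast
  then show "linear_form (C x y)" by (rule bilinear_formD)
qed

lemma bilinear_form_expand:
  assumes "bilinear_form B"
  shows "B (smul s x + y) (smul s x + y) = s ^ 2 * B x x + 2 * s * B x y + B y y"
proof -
  have "B x y = B y x" using assms by (auto simp: bilinear_form_def)
  then show ?thesis
    by (simp add: linear_formD[OF bilinear_formD(1)[OF assms]]
      linear_formD[OF bilinear_formD(2)[OF assms]] algebra_simps power2_eq_square)
qed

lemma trilinear_form_expand:
  assumes "trilinear_form C"
  shows "C (smul s x + y) (smul s x + y) (smul s x + y) =
    s ^ 3 * C x x x + 3 * s ^ 2 * C x x y + 3 * s * C x y y + C y y y"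
proof -
  have sym: "C u v w = C v u w" "C u v w = C u w v" for u v w
    using assms unfolding trilinear_form_def by blast+
  have lin: "linear_form (\<lambda>x. C x u v)" for u v
    using assms unfolding trilinear_form_def by blast
  have "C (smul s x + y) (smul s x + y) (smul s x + y) =
      s * C x (smul s x + y) (smul s x + y) + C y (smul s x + y) (smul s x + y)"
    by (simp add: linear_formD[OF lin])
  also have "\<dots> = s * (s ^ 2 * C x x x + 2 * s * C x x y + C x y y) +
      (s ^ 2 * C y x x + 2 * s * C y x y + C y y y)"
    by (simp add: bilinear_form_expand[OF trilinear_formD(1)[OF assms]])
  finally show ?thesis
    using sym(1)[of y x x] sym(2)[of x y x] sym(1)[of y x y]
    by (simp add: algebra_simps power2_eq_square power3_eq_cube)
qed

text \<open>A linear form on infinite sequences need not be determined by its values on the unit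
  vectors; on sequences cut off after \<open>n\<close> entries it is.\<close>

lemma linear_form_eq_sum:
  assumes "linear_form f"
  shows "f (\<lambda>i. if i < n then c i else 0) = (\<Sum>j<n. c j * f (\<lambda>i. if i = j then 1 else 0))"
proof (induction n)
  case 0
  have "f (smul 0 0) = 0" by (simp only: linear_formD[OF assms]) simp
  moreover have "smul 0 0 = (\<lambda>i. 0)" by (auto simp: fun_eq_iff)
  ultimately show ?case by simp
next
  case (Suc n)
  have "(\<lambda>i. if i < Suc n then c i else 0) =
      (\<lambda>i. if i < n then c i else 0) + smul (c n) (\<lambda>i. if i = n then 1 else 0)"
    by (auto simp: fun_eq_iff less_Suc_eq)
  then show ?case by (simp add: linear_formD[OF assms] Suc)
qed

text \<open>Quadratic and cubic forms enter through their polarisations: fixing an argument yields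
  the mixed terms as forms of lower degree, which can join the system. Bounds on the lengths instead
  of equalities admit shorter systems directly.\<close>

definition solvable :: "nat \<Rightarrow> nat \<Rightarrow> nat \<Rightarrow> nat \<Rightarrow> bool" where
  "solvable n r q l \<longleftrightarrow> (\<forall>Cs Qs Ls.
     (\<forall>C\<in>set Cs. trilinear_form C) \<and> (\<forall>B\<in>set Qs. bilinear_form B) \<and> (\<forall>L\<in>set Ls. linear_form L) \<and>
     length Cs \<le> r \<and> length Qs \<le> q \<and> length Ls \<le> l \<longrightarrow>
     (\<exists>x. nonzero_in n x \<and> (\<forall>C\<in>set Cs. C x x x = 0) \<and> (\<forall>B\<in>set Qs. B x x = 0) \<and>
       (\<forall>L\<in>set Ls. L x = 0)))"

lemma solvableD:
  assumes "solvable n r q l" "\<And>C. C \<in> set Cs \<Longrightarrow> trilinear_form C"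
    "\<And>B. B \<in> set Qs \<Longrightarrow> bilinear_form B" "\<And>L. L \<in> set Ls \<Longrightarrow> linear_form L"
    "length Cs \<le> r" "length Qs \<le> q" "length Ls \<le> l"
  obtains x where "nonzero_in n x" "\<And>C. C \<in> set Cs \<Longrightarrow> C x x x = 0"
    "\<And>B. B \<in> set Qs \<Longrightarrow> B x x = 0" "\<And>L. L \<in> set Ls \<Longrightarrow> L x = 0"
proof -
  have "\<exists>x. nonzero_in n x \<and> (\<forall>C\<in>set Cs. C x x x = 0) \<and> (\<forall>B\<in>set Qs. B x x = 0) \<and>
      (\<forall>L\<in>set Ls. L x = 0)"
    by (rule assms(1)[unfolded solvable_def, rule_format]) (intro conjI ballI assms)
  then show thesis using that by blast
qed

lemma solvable_linear:
  assumes "l < n"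
  shows "solvable n 0 0 l"
  unfolding solvable_def
proof (intro allI impI, elim conjE)
  fix Cs Qs Ls
  assume Ls: "\<forall>L\<in>set Ls. linear_form L" "length Ls \<le> l"
    and e: "length (Cs :: (vec \<Rightarrow> vec \<Rightarrow> vec \<Rightarrow> q5) list) \<le> 0"
    "length (Qs :: (vec \<Rightarrow> vec \<Rightarrow> q5) list) \<le> 0"
  obtain c where c: "\<exists>j\<in>{..<n}. c j \<noteq> 0"
    "\<forall>i<length Ls. (\<Sum>j<n. c j * (Ls ! i) (\<lambda>i. if i = j then 1 else 0)) = 0"
    using homogeneous_system[of "{..<n}" "length Ls" "\<lambda>i j. (Ls ! i) (\<lambda>i. if i = j then 1 else 0)"]
      assms Ls by auto
  define x where "x = (\<lambda>i. if i < n then c i else 0)"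
  have "nonzero_in n x" using c(1) by (auto simp: nonzero_in_def x_def)
  moreover have "L x = 0" if "L \<in> set Ls" for L
  proof -
    have "\<exists>i<length Ls. Ls ! i = L" using that by (simp add: in_set_conv_nth)
    then show ?thesis
      unfolding x_def using linear_form_eq_sum[of L n c] Ls that c(2) by auto
  qed
  ultimately show "\<exists>x. nonzero_in n x \<and> (\<forall>C\<in>set Cs. C x x x = 0) \<and> (\<forall>B\<in>set Qs. B x x = 0) \<and>
       (\<forall>L\<in>set Ls. L x = 0)"
    using e by auto
qed

text \<open>Since \<open>Q m\<close> looks only at entries before \<open>m\<close>, choosing entry
  \<open>k\<close> leaves the earlier choices valid.\<close>

lemma choose_sequence:
  fixes Q :: "nat \<Rightarrow> (nat \<Rightarrow> 'v) \<Rightarrow> 'v \<Rightarrow> bool"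
  assumes "\<And>m y. m < k \<Longrightarrow> \<exists>z. Q m y z"
    and "\<And>m y y' z. (\<And>j. j < m \<Longrightarrow> y j = y' j) \<Longrightarrow> Q m y z \<Longrightarrow> Q m y' z"
  shows "\<exists>y. \<forall>m<k. Q m y (y m)"
  using assms(1)
proof (induction k)
  case 0
  show ?case by simp
next
  case (Suc k)
  then obtain y where y: "\<forall>m<k. Q m y (y m)" by auto
  obtain z where z: "Q k y z" using Suc.prems by blast
  have "Q m (y(k := z)) ((y(k := z)) m)" if "m < Suc k" for m
    using that y z assms(2)[of m y "y(k := z)"] by (cases "m = k") auto
  then show ?case by blast
qed

text \<open>Demanding that later vectors vanish at a coordinate where an earlier one does not keeps
  the chosen vectors independent at the price of one linear condition each.\<close>

definition pivot :: "nat \<Rightarrow> vec \<Rightarrow> nat" where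
  "pivot n x = (SOME i. i < n \<and> x i \<noteq> 0)"

lemma nonzero_in_combination:
  assumes "nonzero_in n x" "nonzero_in n y" "y (pivot n x) = 0"
  shows "nonzero_in n (smul s x + y)"
proof (cases "s = 0")
  case True
  then show ?thesis using assms(2) by (simp add: nonzero_in_def)
next
  case False
  have "pivot n x < n \<and> x (pivot n x) \<noteq> 0"
    unfolding pivot_def using assms(1)[unfolded nonzero_in_def] by (rule someI_ex)
  then show ?thesis
    using False assms(3) unfolding nonzero_in_def by (intro exI[of _ "pivot n x"]) simp
qed

text \<open>Five zeros of the other \<open>q\<close> quadratic forms are chosen, each orthogonal to
  its predecessors for all \<open>Suc q\<close> forms. Unless \<open>B0\<close> vanishes at one of
  them, two of its values share a square class, and a combination of those two vectors kills
  \<open>B0\<close>. Each of at most four predecessors costs \<open>Suc q\<close> orthogonality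
  conditions and one pivot condition.\<close>

lemma solvable_quadratic_step:
  assumes sol: "solvable n 0 q (l + 4 * Suc q + 4)"
  shows "solvable n 0 (Suc q) l"
  unfolding solvable_def
proof (intro allI impI, elim conjE)
  fix Cs :: "(vec \<Rightarrow> vec \<Rightarrow> vec \<Rightarrow> q5) list" and Qs Ls
  assume Cs: "length Cs \<le> 0" and Qs: "\<forall>B\<in>set Qs. bilinear_form B" "length Qs \<le> Suc q"
    and Ls: "\<forall>L\<in>set Ls. linear_form L" "length Ls \<le> l"
  let ?goal = "\<lambda>x. nonzero_in n x \<and> (\<forall>B\<in>set Qs. B x x = 0) \<and> (\<forall>L\<in>set Ls. L x = 0)"
  have "\<exists>x. ?goal x"
  proof (cases Qs)
    case Nil
    obtain x where "nonzero_in n x" "\<And>L. L \<in> set Ls \<Longrightarrow> L x = 0"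
      by (rule solvableD[OF sol, of "[]" "[]" Ls]) (use Ls in auto)
    then show ?thesis using Nil by auto
  next
    case (Cons B0 Qs')
    define Q where "Q m y z \<longleftrightarrow> nonzero_in n z \<and> (\<forall>L\<in>set Ls. L z = 0) \<and> (\<forall>B\<in>set Qs'. B z z = 0) \<and>
      (\<forall>j<m. (\<forall>B\<in>set Qs. B (y j) z = 0) \<and> z (pivot n (y j)) = 0)" for m :: nat and y z
    have "\<exists>y. \<forall>m<5. Q m y (y m)"
    proof (rule choose_sequence)
      fix m :: nat and y :: "nat \<Rightarrow> vec"
      assume m: "m < 5"
      define Ls' where "Ls' = Ls @ map (\<lambda>(B, j). B (y j)) (List.product Qs [0..<m]) @
        map (\<lambda>j x. x (pivot n (y j))) [0..<m]"
      have "length Qs * m \<le> Suc q * 4" using Qs m by (intro mult_le_mono) auto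
      then have len: "length Ls' \<le> l + 4 * Suc q + 4"
        using Ls(2) m by (simp add: Ls'_def)
      obtain z where "nonzero_in n z" "\<And>B. B \<in> set Qs' \<Longrightarrow> B z z = 0" "\<And>L. L \<in> set Ls' \<Longrightarrow> L z = 0"
      proof (rule solvableD[OF sol, of "[]" Qs' Ls'])
        show "linear_form L" if "L \<in> set Ls'" for L
          using that Ls Qs by (auto simp: Ls'_def bilinear_formD linear_form_coordinate)
      qed (use Qs Cons len in auto)
      then have "Q m y z" unfolding Q_def by (fastforce simp: Ls'_def)
      then show "\<exists>z. Q m y z" by blast
    qed (simp add: Q_def)
    then obtain y where y: "\<And>m. m < 5 \<Longrightarrow> Q m y (y m)" by blast
    show ?thesis
    proof (cases "\<exists>m<5. B0 (y m) (y m) = 0")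
      case True
      then obtain m where "m < 5" "B0 (y m) (y m) = 0" by blast
      then show ?thesis using y[of m] Cons by (intro exI[of _ "y m"]) (auto simp: Q_def)
    next
      case False
      then obtain i j s where ij: "i < j" "j < 5"
        "s ^ 2 * B0 (y i) (y i) + B0 (y j) (y j) = 0"
        using q5_same_square_class[of "\<lambda>i. B0 (y i) (y i)"] by blast
      have diag: "nonzero_in n (y m)" "\<forall>L\<in>set Ls. L (y m) = 0" "\<forall>B\<in>set Qs'. B (y m) (y m) = 0"
        if "m < 5" for m
        using y[OF that] unfolding Q_def by - (elim conjE, assumption)+
      have "\<forall>k<j. (\<forall>B\<in>set Qs. B (y k) (y j) = 0) \<and> y j (pivot n (y k)) = 0"
        using y[OF ij(2)] unfolding Q_def by (elim conjE)
      then have cross: "\<forall>B\<in>set Qs. B (y i) (y j) = 0" "y j (pivot n (y i)) = 0"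
        using ij(1) by simp_all
      have i: "i < 5" using ij by simp
      have "?goal (smul s (y i) + y j)"
      proof (intro conjI ballI)
        show "nonzero_in n (smul s (y i) + y j)"
          using diag(1)[OF i] diag(1)[OF ij(2)] cross(2) by (rule nonzero_in_combination)
        show "L (smul s (y i) + y j) = 0" if "L \<in> set Ls" for L
          using bspec[OF diag(2)[OF i] that] bspec[OF diag(2)[OF ij(2)] that] bspec[OF Ls(1) that]
          by (simp add: linear_formD)
        show "B (smul s (y i) + y j) (smul s (y i) + y j) = 0" if B: "B \<in> set Qs" for B
        proof (cases "B \<in> set Qs'")
          case True
          then show ?thesis
            using bspec[OF diag(3)[OF i] True] bspec[OF diag(3)[OF ij(2)] True] bspec[OF cross(1) B]
              bspec[OF Qs(1) B]
            by (simp add: bilinear_form_expand)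
        next
          case False
          then have "B = B0" using B Cons by simp
          then show ?thesis
            using bspec[OF cross(1) B] bspec[OF Qs(1) B] ij(3) by (simp add: bilinear_form_expand)
        qed
      qed
      then show ?thesis by blast
    qed
  qed
  then show "\<exists>x. nonzero_in n x \<and> (\<forall>C\<in>set Cs. C x x x = 0) \<and> (\<forall>B\<in>set Qs. B x x = 0) \<and>
       (\<forall>L\<in>set Ls. L x = 0)"
    using Cs by simp
qed

text \<open>As for quadratic forms, but with three cube classes four vectors suffice. Each of at
  most three predecessors \<open>y\<close> requires both \<open>C y y z\<close> and
  \<open>C y z z\<close> to vanish; the latter is quadratic in the new vector \<open>z\<close>,
  whence the \<open>3 * Suc r\<close> additional quadratic forms.\<close>

lemma solvable_cubic_step:
  assumes sol: "solvable n r (q + 3 * Suc r) (l + 3 * q + 9 * Suc r + 3)"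
  shows "solvable n (Suc r) q l"
  unfolding solvable_def
proof (intro allI impI, elim conjE)
  fix Cs :: "(vec \<Rightarrow> vec \<Rightarrow> vec \<Rightarrow> q5) list" and Qs Ls
  assume Cs: "\<forall>C\<in>set Cs. trilinear_form C" "length Cs \<le> Suc r"
    and Qs: "\<forall>B\<in>set Qs. bilinear_form B" "length Qs \<le> q"
    and Ls: "\<forall>L\<in>set Ls. linear_form L" "length Ls \<le> l"
  let ?goal = "\<lambda>x. nonzero_in n x \<and> (\<forall>C\<in>set Cs. C x x x = 0) \<and> (\<forall>B\<in>set Qs. B x x = 0) \<and>
    (\<forall>L\<in>set Ls. L x = 0)"
  show "\<exists>x. ?goal x"
  proof (cases Cs)
    case Nil
    obtain x where "nonzero_in n x" "\<And>B. B \<in> set Qs \<Longrightarrow> B x x = 0" "\<And>L. L \<in> set Ls \<Longrightarrow> L x = 0"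
      by (rule solvableD[OF sol, of "[]" Qs Ls]) (use Ls Qs in auto)
    then show ?thesis using Nil by auto
  next
    case (Cons C0 Cs')
    define Q where "Q m y z \<longleftrightarrow> nonzero_in n z \<and> (\<forall>L\<in>set Ls. L z = 0) \<and> (\<forall>B\<in>set Qs. B z z = 0) \<and>
      (\<forall>C\<in>set Cs'. C z z z = 0) \<and>
      (\<forall>j<m. (\<forall>B\<in>set Qs. B (y j) z = 0) \<and> z (pivot n (y j)) = 0 \<and>
        (\<forall>C\<in>set Cs. C (y j) (y j) z = 0 \<and> C (y j) z z = 0))" for m :: nat and y z
    have "\<exists>y. \<forall>m<4. Q m y (y m)"
    proof (rule choose_sequence)
      fix m :: nat and y :: "nat \<Rightarrow> vec"
      assume m: "m < 4"
      define Ls' where "Ls' = Ls @ map (\<lambda>(B, j). B (y j)) (List.product Qs [0..<m]) @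
        map (\<lambda>(C, j). C (y j) (y j)) (List.product Cs [0..<m]) @
        map (\<lambda>j x. x (pivot n (y j))) [0..<m]"
      define Qs' where "Qs' = Qs @ map (\<lambda>(C, j). C (y j)) (List.product Cs [0..<m])"
      have 1: "length Qs * m \<le> q * 3" using Qs m by (intro mult_le_mono) auto
      have 2: "length Cs * m \<le> Suc r * 3" using Cs m by (intro mult_le_mono) auto
      have len: "length Ls' \<le> l + 3 * q + 9 * Suc r + 3"
        using Ls(2) m 1 2 by (simp add: Ls'_def)
      have len2: "length Qs' \<le> q + 3 * Suc r"
        using Qs(2) 2 by (simp add: Qs'_def)
      obtain z where z: "nonzero_in n z" "\<And>C. C \<in> set Cs' \<Longrightarrow> C z z z = 0"
        "\<And>B. B \<in> set Qs' \<Longrightarrow> B z z = 0" "\<And>L. L \<in> set Ls' \<Longrightarrow> L z = 0"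
      proof (rule solvableD[OF sol, of Cs' Qs' Ls'])
        show "linear_form L" if "L \<in> set Ls'" for L
          using that Ls Qs Cs
          by (auto simp: Ls'_def bilinear_formD trilinear_formD linear_form_coordinate)
        show "bilinear_form B" if "B \<in> set Qs'" for B
          using that Qs Cs by (auto simp: Qs'_def trilinear_formD)
      qed (use Cs Cons len len2 in auto)
      have "C (y j) z z = 0" if "C \<in> set Cs" "j < m" for C j
        using that by (intro z(3)) (force simp: Qs'_def)
      moreover have "C (y j) (y j) z = 0" if "C \<in> set Cs" "j < m" for C j
        using that by (intro z(4)) (force simp: Ls'_def)
      moreover have "B (y j) z = 0" if "B \<in> set Qs" "j < m" for B j
        using that by (intro z(4)) (force simp: Ls'_def)
      moreover have "z (pivot n (y j)) = 0" if "j < m" for j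
        using that z(4)[of "\<lambda>x. x (pivot n (y j))"] by (force simp: Ls'_def)
      ultimately have "Q m y z"
        unfolding Q_def using z by (auto simp: Ls'_def Qs'_def)
      then show "\<exists>z. Q m y z" by blast
    qed (simp add: Q_def)
    then obtain y where y: "\<And>m. m < 4 \<Longrightarrow> Q m y (y m)" by blast
    show ?thesis
    proof (cases "\<exists>m<4. C0 (y m) (y m) (y m) = 0")
      case True
      then obtain m where "m < 4" "C0 (y m) (y m) (y m) = 0" by blast
      then show ?thesis using y[of m] Cons by (intro exI[of _ "y m"]) (auto simp: Q_def)
    next
      case False
      then obtain i j s where ij: "i < j" "j < 4"
        "s ^ 3 * C0 (y i) (y i) (y i) + C0 (y j) (y j) (y j) = 0"
        using q5_same_cube_class[of "\<lambda>i. C0 (y i) (y i) (y i)"] by blast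
      have diag: "nonzero_in n (y m)" "\<forall>L\<in>set Ls. L (y m) = 0" "\<forall>B\<in>set Qs. B (y m) (y m) = 0"
        "\<forall>C\<in>set Cs'. C (y m) (y m) (y m) = 0" if "m < 4" for m
        using y[OF that] unfolding Q_def by - (elim conjE, assumption)+
      have "\<forall>k<j. (\<forall>B\<in>set Qs. B (y k) (y j) = 0) \<and> y j (pivot n (y k)) = 0 \<and>
          (\<forall>C\<in>set Cs. C (y k) (y k) (y j) = 0 \<and> C (y k) (y j) (y j) = 0)"
        using y[OF ij(2)] unfolding Q_def by (elim conjE)
      then have cross: "\<forall>B\<in>set Qs. B (y i) (y j) = 0" "y j (pivot n (y i)) = 0"
        "\<forall>C\<in>set Cs. C (y i) (y i) (y j) = 0 \<and> C (y i) (y j) (y j) = 0"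
        using ij(1) by simp_all
      have i: "i < 4" using ij by simp
      have "?goal (smul s (y i) + y j)"
      proof (intro conjI ballI)
        show "nonzero_in n (smul s (y i) + y j)"
          using diag(1)[OF i] diag(1)[OF ij(2)] cross(2) by (rule nonzero_in_combination)
        show "L (smul s (y i) + y j) = 0" if "L \<in> set Ls" for L
          using bspec[OF diag(2)[OF i] that] bspec[OF diag(2)[OF ij(2)] that] bspec[OF Ls(1) that]
          by (simp add: linear_formD)
        show "B (smul s (y i) + y j) (smul s (y i) + y j) = 0" if B: "B \<in> set Qs" for B
          using bspec[OF diag(3)[OF i] B] bspec[OF diag(3)[OF ij(2)] B] bspec[OF cross(1) B]
            bspec[OF Qs(1) B]
          by (simp add: bilinear_form_expand)
        show "C (smul s (y i) + y j) (smul s (y i) + y j) (smul s (y i) + y j) = 0"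
          if C: "C \<in> set Cs" for C
        proof (cases "C \<in> set Cs'")
          case True
          then show ?thesis
            using bspec[OF diag(4)[OF i] True] bspec[OF diag(4)[OF ij(2)] True] bspec[OF cross(3) C]
              bspec[OF Cs(1) C]
            by (simp add: trilinear_form_expand)
        next
          case False
          then have "C = C0" using C Cons by simp
          then show ?thesis
            using bspec[OF cross(3) C] bspec[OF Cs(1) C] ij(3) by (simp add: trilinear_form_expand)
        qed
      qed
      then show ?thesis by blast
    qed
  qed
qed

text \<open>Removing the \<open>k\<close>-th quadratic form costs \<open>4 * k + 4\<close> linear
  ones; summed over \<open>k\<close> from 1 to \<open>q\<close> this is
  \<open>2 * q ^ 2 + 6 * q\<close>.\<close>

lemma solvable_quadratic:
  "l + 2 * q ^ 2 + 6 * q < n \<Longrightarrow> solvable n 0 q l"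
proof (induction q arbitrary: l)
  case 0
  then show ?case using solvable_linear by simp
next
  case (Suc q)
  have "(l + 4 * Suc q + 4) + 2 * q ^ 2 + 6 * q < n"
    using Suc.prems by (simp add: power2_eq_square)
  then show ?case by (intro solvable_quadratic_step Suc.IH)
qed

fun system_bound :: "nat \<Rightarrow> nat \<Rightarrow> nat \<Rightarrow> nat" where
  "system_bound 0 q l = l + 2 * q ^ 2 + 6 * q"
| "system_bound (Suc r) q l = system_bound r (q + 3 * Suc r) (l + 3 * q + 9 * Suc r + 3)"

lemma solvable_system: "system_bound r q l < n \<Longrightarrow> solvable n r q l"
  by (induction r q l rule: system_bound.induct)
    (auto intro: solvable_quadratic solvable_cubic_step simp del: mult_Suc_right)

lemma system_bound_value: "system_bound 25 375 3125 \<le> 4562911"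
proof -
  have step: "system_bound (numeral r) q l =
      system_bound (pred_numeral r) (q + 3 * numeral r) (l + 3 * q + 9 * numeral r + 3)" for r q l
    by (simp add: numeral_eq_Suc)
  show ?thesis by (simp add: step numeral_2_eq_2  del: system_bound.simps(2))
      simp
qed

section \<open>Anisotropic quintic forms\<close>

text \<open>Contrapositives of the existence of roots: a non-integral \<open>D\<close> dominates
  after rescaling, a unit \<open>D\<close> gives a root unless its residue is opposite to
  \<open>\<alpha>\<close>, and if 5 divides \<open>R\<close> then 0 is a root modulo 5, simple when
  \<open>D\<close> is a unit.\<close>

lemma no_root_linear:
  assumes no_root: "\<And>x. a * x ^ 5 + D * x + R \<noteq> 0" and R: "integral R" and a: "cg a \<alpha>"
  shows "integral D" "5 dvd \<alpha> \<Longrightarrow> cg D 0" "5 dvd \<alpha> - 1 \<Longrightarrow> cg D 0 \<or> cg D (- 1)"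
    "cg R 0 \<Longrightarrow> cg D 0"
proof -
  show D: "integral D"
  proof (rule ccontr)
    assume D: "\<not> integral D"
    have "cg (a * inverse D ^ 5) (\<alpha> * 0 ^ 5)"
      by (intro cg_intros a not_integral_inverse(2) D)
    then have "cg (a / D ^ 5) 0" by (simp add: divide_inverse power_inverse)
    then show False
      using root_dominant_linear[of D a R] not_integral_inverse(1)[OF D] R no_root by blast
  qed
  then obtain \<delta> where \<delta>: "cg D \<delta>" by (auto simp: integral_iff_cg)
  have "5 dvd \<delta> \<or> 5 dvd \<alpha> + \<delta>"
    using root_unit_linear[OF a \<delta>] R no_root by blast
  then show "cg D 0" if "5 dvd \<alpha>"
    using that \<delta> by (metis cg_dvd_0 dvd_add_right_iff)
  show "cg D 0 \<or> cg D (- 1)" if "5 dvd \<alpha> - 1"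
    using \<open>5 dvd \<delta> \<or> 5 dvd \<alpha> + \<delta>\<close>
  proof
    assume "5 dvd \<alpha> + \<delta>"
    then have "5 dvd (\<alpha> - 1) - (\<alpha> + \<delta>)" using that by (rule dvd_diff[rotated])
    then show ?thesis using cg_dvd[OF \<delta>, of "- 1"] by simp
  qed (use \<delta> cg_dvd_0 in blast)
  show "cg D 0" if R0: "cg R 0"
  proof (rule ccontr)
    assume "\<not> cg D 0"
    then have "\<not> 5 dvd \<delta>" using \<delta> cg_dvd_0 by blast
    obtain x where "R + D * x + 0 * x ^ 2 + 0 * x ^ 3 + 0 * x ^ 4 + a * x ^ 5 = 0"
      by (rule hensel_quintic[of R D 0 0 0 a 0 \<delta>])
        (use R0 D a R \<delta> cg_imp_integral \<open>\<not> 5 dvd \<delta>\<close> in \<open>auto intro: integral_intros\<close>)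
    then show False using no_root[of x] by (simp add: algebra_simps)
  qed
qed

text \<open>The adjacent transpositions generate all permutations of the arguments. As vectors are
  infinite sequences, \<open>null\<close> is what makes \<open>M\<close> insensitive to the
  coordinates from \<open>n\<close> on.\<close>

locale anisotropic_quintic =
  fixes n :: nat and M :: "vec \<Rightarrow> vec \<Rightarrow> vec \<Rightarrow> vec \<Rightarrow> vec \<Rightarrow> q5"
  assumes linear1: "linear_form (\<lambda>x. M x b c d e)"
    and swap12: "M a b c d e = M b a c d e" and swap23: "M a b c d e = M a c b d e"
    and swap34: "M a b c d e = M a b d c e" and swap45: "M a b c d e = M a b c e d"
    and null: "\<not> nonzero_in n x \<Longrightarrow> M x b c d e = 0"
    and anisotropic: "nonzero_in n x \<Longrightarrow> M x x x x x \<noteq> 0"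
begin

lemma linear2: "linear_form (\<lambda>x. M a x c d e)" using linear1[of a] swap12[of a] by simp
lemma linear3: "linear_form (\<lambda>x. M a b x d e)" using linear2[of a b] swap23[of a b] by simp
lemma linear4: "linear_form (\<lambda>x. M a b c x e)" using linear3[of a b c] swap34[of a b c] by simp
lemma linear5: "linear_form (\<lambda>x. M a b c d x)" using linear4[of a b c d] swap45[of a b c d] by simp

lemmas expand = linear_formD[OF linear1] linear_formD[OF linear2] linear_formD[OF linear3]
  linear_formD[OF linear4] linear_formD[OF linear5]

definition F :: "vec \<Rightarrow> q5" where "F x = M x x x x x"

lemma F_smul: "F (smul t x) = t ^ 5 * F x"
  by (simp add: F_def expand power_numeral_reduce)

text \<open>The span as a double annihilator: this is the form in which vanishing of
  \<open>M\<close> passes from \<open>A\<close> to its span, one linear argument at a time.\<close>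

definition span :: "vec set \<Rightarrow> vec set" where
  "span A = {x. \<forall>f. linear_form f \<longrightarrow> (\<forall>a\<in>A. f a = 0) \<longrightarrow> f x = 0}"

lemma linear_form_span:
  "x \<in> span A \<Longrightarrow> linear_form f \<Longrightarrow> (\<And>a. a \<in> A \<Longrightarrow> f a = 0) \<Longrightarrow> f x = 0"
  by (simp add: span_def)

lemma span_base: "a \<in> A \<Longrightarrow> a \<in> span A"
  and span_add: "x \<in> span A \<Longrightarrow> y \<in> span A \<Longrightarrow> x + y \<in> span A"
  and span_smul: "x \<in> span A \<Longrightarrow> smul c x \<in> span A"
  by (auto simp: span_def linear_formD)

lemmas span_intros = span_add span_smul span_base

text \<open>Up to multinomial factors these are the coefficients of the monomials in \<open>F (\<Sum> t\<^sub>a a + s x)\<close>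
  that have degree 1 or 2 in \<open>s\<close>, and of the monomials \<open>t\<^sub>a\<^sup>2 s\<^sup>3\<close>.\<close>

definition orth :: "vec set \<Rightarrow> vec \<Rightarrow> bool" where
  "orth A x \<longleftrightarrow> (\<forall>a\<in>A. \<forall>b\<in>A. \<forall>c\<in>A. \<forall>d\<in>A. M a b c d x = 0) \<and>
     (\<forall>a\<in>A. \<forall>b\<in>A. \<forall>c\<in>A. M a b c x x = 0) \<and> (\<forall>a\<in>A. M a a x x x = 0)"

lemma orth_subset: "orth A x \<Longrightarrow> B \<subseteq> A \<Longrightarrow> orth B x"
  unfolding orth_def by blast

lemma orth_smul: "orth A x \<Longrightarrow> orth A (smul c x)"
  by (simp add: orth_def expand)

lemma orth_linear:
  assumes "orth A z" "a \<in> span A" "b \<in> span A" "c \<in> span A" "d \<in> span A"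
  shows "M a b c d z = 0"
proof -
  have "M a b c d z = 0" if "a \<in> A" "b \<in> A" "c \<in> A" "d \<in> A" for a b c d
    using assms(1) that by (auto simp: orth_def)
  then have "M a b c d z = 0" if "a \<in> A" "b \<in> A" "c \<in> A" for a b c
    using linear_form_span[OF assms(5) linear4] that by blast
  then have "M a b c d z = 0" if "a \<in> A" "b \<in> A" for a b
    using linear_form_span[OF assms(4) linear3] that by blast
  then have "M a b c d z = 0" if "a \<in> A" for a
    using linear_form_span[OF assms(3) linear2] that by blast
  then show ?thesis
    using linear_form_span[OF assms(2) linear1] by blast
qed

lemma orth_quadratic:
  assumes "orth A z" "a \<in> span A" "b \<in> span A" "c \<in> span A"
  shows "M a b c z z = 0"
proof -
  have "M a b c z z = 0" if "a \<in> A" "b \<in> A" "c \<in> A" for a b c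
    using assms(1) that by (auto simp: orth_def)
  then have "M a b c z z = 0" if "a \<in> A" "b \<in> A" for a b
    using linear_form_span[OF assms(4) linear3] that by blast
  then have "M a b c z z = 0" if "a \<in> A" for a
    using linear_form_span[OF assms(3) linear2] that by blast
  then show ?thesis
    using linear_form_span[OF assms(2) linear1] by blast
qed

lemma orth_cubic: "orth A z \<Longrightarrow> a \<in> A \<Longrightarrow> M a a z z z = 0"
  by (auto simp: orth_def)

section \<open>Expansion of \<open>F\<close> along orthogonal vectors\<close>

lemma F_add: "F (X + Y) = F X + 5 * M X X X X Y + 10 * M X X X Y Y + 10 * M X X Y Y Y +
    5 * M X Y Y Y Y + F Y"
proof -
  have "M Y X X X X = M X X X X Y" "M X Y X X X = M X X X X Y" "M X X Y X X = M X X X X Y"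
    "M X X X Y X = M X X X X Y"
    using swap12 swap23 swap34 swap45 by metis+
  moreover have "M Y Y X X X = M X X X Y Y" "M Y X Y X X = M X X X Y Y" "M Y X X Y X = M X X X Y Y"
    "M Y X X X Y = M X X X Y Y" "M X Y Y X X = M X X X Y Y" "M X Y X Y X = M X X X Y Y"
    "M X Y X X Y = M X X X Y Y" "M X X Y Y X = M X X X Y Y" "M X X Y X Y = M X X X Y Y"
    using swap12 swap23 swap34 swap45 by metis+
  moreover have "M X X Y Y Y = M X X Y Y Y" "M X Y X Y Y = M X X Y Y Y" "M X Y Y X Y = M X X Y Y Y"
    "M X Y Y Y X = M X X Y Y Y" "M Y X X Y Y = M X X Y Y Y" "M Y X Y X Y = M X X Y Y Y"
    "M Y X Y Y X = M X X Y Y Y" "M Y Y X X Y = M X X Y Y Y" "M Y Y X Y X = M X X Y Y Y"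
    "M Y Y Y X X = M X X Y Y Y"
    using swap12 swap23 swap34 swap45 by metis+
  moreover have "M Y X Y Y Y = M X Y Y Y Y" "M Y Y X Y Y = M X Y Y Y Y" "M Y Y Y X Y = M X Y Y Y Y"
    "M Y Y Y Y X = M X Y Y Y Y"
    using swap12 swap23 swap34 swap45 by metis+
  ultimately show ?thesis
    unfolding F_def by (simp add: expand)
qed

text \<open>\<open>E a z\<close> and \<open>H a b z\<close> below are the coefficients of
  \<open>t_a t_z^4\<close> and \<open>t_a t_b t_z^3\<close>, with multinomial factors
  \<open>5! / 4!\<close> and \<open>5! / 3!\<close>.\<close>

definition E :: "vec \<Rightarrow> vec \<Rightarrow> q5" where "E a z = 5 * M a z z z z"

definition H :: "vec \<Rightarrow> vec \<Rightarrow> vec \<Rightarrow> q5" where "H a b z = 20 * M a b z z z"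

lemma E_combination: "E (x + y) z = E x z + E y z" "E (smul s x) z = s * E x z"
  by (simp_all add: E_def expand algebra_simps)

lemma F_add_orth:
  assumes "orth A z" "X \<in> span A"
  shows "F (X + smul t z) = F X + 10 * t ^ 3 * M X X z z z + t ^ 4 * E X z + t ^ 5 * F z"
  using orth_linear[OF assms(1) assms(2) assms(2) assms(2) assms(2)]
    orth_quadratic[OF assms(1) assms(2) assms(2) assms(2)]
  by (simp add: F_add F_smul) (simp add: expand E_def power_numeral_reduce)

text \<open>Replaces linear independence: were \<open>X + smul t z\<close> zero in the first
  \<open>n\<close> coordinates, \<open>X\<close> would act in \<open>M\<close> as
  \<open>smul (- t) z\<close>, and the orthogonality relation \<open>M X X X X z = 0\<close> would
  become \<open>t ^ 4 * F z = 0\<close>.\<close>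

lemma F_add_nonzero:
  assumes "orth A z" "X \<in> span A" "nonzero_in n z" "t \<noteq> 0"
  shows "F (X + smul t z) \<noteq> 0"
proof
  assume "F (X + smul t z) = 0"
  then have "\<not> nonzero_in n (X + smul t z)" using anisotropic by (auto simp: F_def)
  then have 1: "M (X + smul t z) b c d e = 0" for b c d e by (rule null)
  have X: "M X b c d e = - t * M z b c d e" for b c d e
    using 1[of b c d e] by (simp add: expand add_eq_0_iff)
  have "M X X X X z = - t * M X z X X z" using X[of X X X z] swap12[of z X] by simp
  also have "M X z X X z = - t * M X z z X z"
    using X[of z X X z] swap23[of z z X X z] swap12[of z X z X z] by simp
  also have "M X z z X z = - t * M X z z z z"
    using X[of z z X z] swap34[of z z z X z] swap23[of z z X z z] swap12[of z X z z z] by simp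
  also have "M X z z z z = - t * F z" using X[of z z z z] by (simp add: F_def)
  finally have "t ^ 4 * F z = 0"
    using orth_linear[OF assms(1) assms(2) assms(2) assms(2) assms(2)]
    by (simp add: power_numeral_reduce)
  then show False using assms(3,4) anisotropic by (simp add: F_def)
qed

lemma F_expand2:
  assumes "orth {p} q"
  shows "F (smul r p + smul s q) = r ^ 5 * F p + r * s ^ 4 * E p q + s ^ 5 * F q"
  using orth_cubic[OF assms, of p]
  by (subst F_add_orth[OF assms], (intro span_intros; simp)) (simp add: F_smul E_combination expand)

text \<open>In the cubic term \<open>10 * M X X w w w\<close> the squares drop out by
  \<open>orth_cubic\<close>; the mixed product occurs twice, which gives the 20 of
  \<open>H\<close>.\<close>

lemma F_expand3:
  assumes "orth {p} q" "orth {p, q} w"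
  shows "F (smul r p + smul s q + smul t w) = r ^ 5 * F p + s ^ 5 * F q + t ^ 5 * F w +
    r * s ^ 4 * E p q + r * t ^ 4 * E p w + s * t ^ 4 * E q w + r * s * t ^ 3 * H p q w"
  using orth_cubic[OF assms(2), of p] orth_cubic[OF assms(2), of q] swap12[of q p w w w]
  by (subst F_add_orth[OF assms(2)], (intro span_intros; simp), subst F_expand2[OF assms(1)])
    (simp add: E_combination expand H_def, simp add: algebra_simps)

lemma F_expand4:
  assumes "orth {p} q" "orth {p, q} w" "orth {p, q, w} v"
  shows "F (smul r p + smul s q + smul t w + smul x v) =
    r ^ 5 * F p + s ^ 5 * F q + t ^ 5 * F w + x ^ 5 * F v +
    r * s ^ 4 * E p q + r * t ^ 4 * E p w + s * t ^ 4 * E q w + r * s * t ^ 3 * H p q w +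
    r * x ^ 4 * E p v + s * x ^ 4 * E q v + t * x ^ 4 * E w v +
    r * s * x ^ 3 * H p q v + r * t * x ^ 3 * H p w v + s * t * x ^ 3 * H q w v"
  using orth_cubic[OF assms(3), of p] orth_cubic[OF assms(3), of q] orth_cubic[OF assms(3), of w]
    swap12[of q p v v v] swap12[of w p v v v] swap12[of w q v v v]
  by (subst F_add_orth[OF assms(3)], (intro span_intros; simp), subst F_expand3[OF assms(1,2)])
    (simp add: E_combination expand H_def, simp add: algebra_simps)

lemma F_expand5:
  assumes "orth {p} q" "orth {p, q} w" "orth {p, q, w} v" "orth {p, q, w, v} v'"
  shows "F (smul r p + smul s q + smul t w + smul x v + smul y v') =
    r ^ 5 * F p + s ^ 5 * F q + t ^ 5 * F w + x ^ 5 * F v + y ^ 5 * F v' +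
    r * s ^ 4 * E p q + r * t ^ 4 * E p w + s * t ^ 4 * E q w + r * s * t ^ 3 * H p q w +
    r * x ^ 4 * E p v + s * x ^ 4 * E q v + t * x ^ 4 * E w v +
    r * s * x ^ 3 * H p q v + r * t * x ^ 3 * H p w v + s * t * x ^ 3 * H q w v +
    r * y ^ 4 * E p v' + s * y ^ 4 * E q v' + t * y ^ 4 * E w v' + x * y ^ 4 * E v v' +
    r * s * y ^ 3 * H p q v' + r * t * y ^ 3 * H p w v' + r * x * y ^ 3 * H p v v' +
    s * t * y ^ 3 * H q w v' + s * x * y ^ 3 * H q v v' + t * x * y ^ 3 * H w v v'"
  using orth_cubic[OF assms(4), of p] orth_cubic[OF assms(4), of q] orth_cubic[OF assms(4), of w]
    orth_cubic[OF assms(4), of v]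
    swap12[of q p v' v' v'] swap12[of w p v' v' v'] swap12[of w q v' v' v']
    swap12[of v p v' v' v'] swap12[of v q v' v' v'] swap12[of v w v' v' v']
  by (subst F_add_orth[OF assms(4)], (intro span_intros; simp), subst F_expand4[OF assms(1-3)])
    (simp add: E_combination expand H_def, simp add: algebra_simps)

end

section \<open>A quartic form modulo 5\<close>

lemma mod_5_cases: "(x::int) mod 5 \<in> {0, 1, 2, 3, 4}"
  by (simp, presburger)

text \<open>The six values constrained to \<open>{0, 4}\<close> are those of
  \<open>a x^4 + b x^3 y + 6 e x^2 y^2 + c x y^3 + d y^4\<close> at the six points of the projective
  line over the field of 5 elements. Scaling a point does not matter, as fourth powers of units are
  1 modulo 5. The rest is enumeration.\<close>

lemma quartic_residues_aux:
  fixes a b e c d :: int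
  assumes "a \<in> {0, 4}" "d \<in> {0, 4}" "e \<in> {0, 1, 2, 3, 4}" "b \<in> {0, 1, 2, 3, 4}"
    "c \<in> {0, 1, 2, 3, 4}"
    "(a + b + 6 * e + c + d) mod 5 \<in> {0, 4}" "(a - b + 6 * e - c + d) mod 5 \<in> {0, 4}"
    "(a + 2 * b + 24 * e + 8 * c + 16 * d) mod 5 \<in> {0, 4}"
    "(a - 2 * b + 24 * e - 8 * c + 16 * d) mod 5 \<in> {0, 4}"
  shows "e = 0 \<and> (a = 0 \<and> b = 0 \<and> c = 0 \<and> d = 0 \<or> a = 4 \<and> d = 0 \<or> a = 0 \<and> d = 4) \<or>
    a = 4 \<and> d = 4 \<and> (e = 4 \<and> (b = 1 \<and> c = 1 \<or> b = 4 \<and> c = 4) \<or> e = 1 \<and> b + c = 5)"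
proof -
  have "\<forall>a\<in>{0, 4}. \<forall>d\<in>{0, 4}. \<forall>e\<in>{0, 1, 2, 3, 4}. \<forall>b\<in>{0, 1, 2, 3, 4}. \<forall>c\<in>{0, 1, 2, 3, 4 :: int}.
    (a + b + 6 * e + c + d) mod 5 \<in> {0, 4} \<longrightarrow> (a - b + 6 * e - c + d) mod 5 \<in> {0, 4} \<longrightarrow>
    (a + 2 * b + 24 * e + 8 * c + 16 * d) mod 5 \<in> {0, 4} \<longrightarrow>
    (a - 2 * b + 24 * e - 8 * c + 16 * d) mod 5 \<in> {0, 4} \<longrightarrow>
    e = 0 \<and> (a = 0 \<and> b = 0 \<and> c = 0 \<and> d = 0 \<or> a = 4 \<and> d = 0 \<or> a = 0 \<and> d = 4) \<or>
    a = 4 \<and> d = 4 \<and> (e = 4 \<and> (b = 1 \<and> c = 1 \<or> b = 4 \<and> c = 4) \<or> e = 1 \<and> b + c = 5)"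
    by code_simp
  from bspec[OF bspec[OF bspec[OF bspec[OF bspec[OF this assms(1)] assms(2)] assms(3)] assms(4)]
    assms(5), rule_format, OF assms(6-9)]
  show ?thesis .
qed

lemma quartic_residues:
  fixes a b e c d :: int
  assumes "a mod 5 \<in> {0, 4}" "d mod 5 \<in> {0, 4}"
    "(a + b + 6 * e + c + d) mod 5 \<in> {0, 4}" "(a - b + 6 * e - c + d) mod 5 \<in> {0, 4}"
    "(a + 2 * b + 24 * e + 8 * c + 16 * d) mod 5 \<in> {0, 4}"
    "(a - 2 * b + 24 * e - 8 * c + 16 * d) mod 5 \<in> {0, 4}"
  shows "e mod 5 = 0 \<and> (a mod 5 = 0 \<and> b mod 5 = 0 \<and> c mod 5 = 0 \<and> d mod 5 = 0 \<or>
      a mod 5 = 4 \<and> d mod 5 = 0 \<or> a mod 5 = 0 \<and> d mod 5 = 4) \<or>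
    a mod 5 = 4 \<and> d mod 5 = 4 \<and> (e mod 5 = 4 \<and> (b mod 5 = 1 \<and> c mod 5 = 1 \<or> b mod 5 = 4 \<and> c mod 5 = 4) \<or>
      e mod 5 = 1 \<and> (b mod 5 + c mod 5 = 5))"
proof -
  have res: "(a + b + 6 * e + c + d) mod 5 = (a mod 5 + b mod 5 + 6 * (e mod 5) + c mod 5 + d mod 5) mod 5"
    "(a - b + 6 * e - c + d) mod 5 = (a mod 5 - b mod 5 + 6 * (e mod 5) - c mod 5 + d mod 5) mod 5"
    "(a + 2 * b + 24 * e + 8 * c + 16 * d) mod 5 =
      (a mod 5 + 2 * (b mod 5) + 24 * (e mod 5) + 8 * (c mod 5) + 16 * (d mod 5)) mod 5"
    "(a - 2 * b + 24 * e - 8 * c + 16 * d) mod 5 =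
      (a mod 5 - 2 * (b mod 5) + 24 * (e mod 5) - 8 * (c mod 5) + 16 * (d mod 5)) mod 5"
    by (intro mod_add_cong mod_diff_cong mod_mult_cong refl; simp)+
  have "e mod 5 \<in> {0, 1, 2, 3, 4}" "b mod 5 \<in> {0, 1, 2, 3, 4}" "c mod 5 \<in> {0, 1, 2, 3, 4}"
    by (rule mod_5_cases)+
  with assms show ?thesis
    unfolding res by (intro quartic_residues_aux)
qed

text \<open>The quartic \<open>ea t^4 + eb x^4 + ec y^4 + hab t x^3 + hac t y^3 + hbc x y^3\<close>
  becomes zero modulo 5, coefficient by coefficient in \<open>x\<close>, after setting
  \<open>y = 1\<close> and \<open>t = - (x + 1)\<close>. The coefficient of \<open>x^2\<close> is
  \<open>6 * ea\<close>, and 6 is a unit.\<close>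

definition vanishes :: "int \<Rightarrow> int \<Rightarrow> int \<Rightarrow> int \<Rightarrow> int \<Rightarrow> int \<Rightarrow> bool" where
  "vanishes ea eb ec hab hac hbc \<longleftrightarrow> 5 dvd ea + eb - hab \<and> 5 dvd 4 * ea - hab \<and> 5 dvd ea \<and>
     5 dvd 4 * ea - hac + hbc \<and> 5 dvd ea + ec - hac"

text \<open>Eliminating \<open>t\<close> leaves a ternary quartic. Its restrictions to
  \<open>z = 0\<close>, \<open>y = 0\<close> and \<open>x = 0\<close> are binary quartics sharing
  the middle coefficient \<open>6 * e1\<close>, so \<open>quartic_residues\<close> leaves only the
  residues 0, 1 and 4 for \<open>e1\<close>.\<close>

lemma quartic_vanishes_on_coordinate_plane:
  fixes e1 e2 e3 e4 h12 h13 h14 h23 h24 h34 :: int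
  assumes D: "\<And>t x y z :: int. t = - (x + y + z) \<Longrightarrow>
    (e1 * t ^ 4 + e2 * x ^ 4 + e3 * y ^ 4 + e4 * z ^ 4 + h12 * (t * x ^ 3) + h13 * (t * y ^ 3) +
      h14 * (t * z ^ 3) + h23 * (x * y ^ 3) + h24 * (x * z ^ 3) + h34 * (y * z ^ 3)) mod 5 \<in> {0, 4}"
  shows "vanishes e1 e2 e3 h12 h13 h23 \<or> vanishes e1 e2 e4 h12 h14 h24 \<or>
    vanishes e1 e3 e4 h13 h14 h34 \<or> vanishes e2 e3 e4 h23 h24 h34"
proof -
  \<comment> \<open>Coefficients of the ternary quartic: \<open>a2\<close>, \<open>a3\<close>,
    \<open>a4\<close> of the fourth powers, \<open>b2\<close> of \<open>x^3 y\<close> and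
    \<open>x^3 z\<close>, \<open>b3\<close> of \<open>y^3 z\<close>, and \<open>c23\<close>,
    \<open>c24\<close>, \<open>c34\<close> of \<open>x y^3\<close>, \<open>x z^3\<close>,
    \<open>y z^3\<close>.\<close>
  define a2 a3 a4 b2 b3 b4 where ab: "a2 = e1 + e2 - h12" "a3 = e1 + e3 - h13" "a4 = e1 + e4 - h14"
    "b2 = 4 * e1 - h12" "b3 = 4 * e1 - h13" "b4 = 4 * e1 - h14"
  define c23 c24 c34 where c: "c23 = b3 + h23" "c24 = b4 + h24" "c34 = b4 + h34"
  note def = ab c
  have e: "e2 = a2 - e1 + h12" "e3 = a3 - e1 + h13" "e4 = a4 - e1 + h14"
    "h12 = 4 * e1 - b2" "h13 = 4 * e1 - b3" "h14 = 4 * e1 - b4"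
    "h23 = c23 - b3" "h24 = c24 - b4" "h34 = c34 - b4"
    by (simp_all add: def)
  have D': "(a2 * x ^ 4 + a3 * y ^ 4 + a4 * z ^ 4 + b2 * (x ^ 3 * (y + z)) + b3 * (y ^ 3 * z) +
      c23 * (x * y ^ 3) + c24 * (x * z ^ 3) + c34 * (y * z ^ 3) +
      6 * e1 * (x ^ 2 * y ^ 2 + x ^ 2 * z ^ 2 + y ^ 2 * z ^ 2) + 12 * e1 * (x * y * z * (x + y + z))) mod 5
      \<in> {0, 4}" for x y z
  proof -
    have "e1 * (- (x + y + z)) ^ 4 + e2 * x ^ 4 + e3 * y ^ 4 + e4 * z ^ 4 + h12 * (- (x + y + z) * x ^ 3) +
      h13 * (- (x + y + z) * y ^ 3) +
      h14 * (- (x + y + z) * z ^ 3) + h23 * (x * y ^ 3) + h24 * (x * z ^ 3) + h34 * (y * z ^ 3) =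
      a2 * x ^ 4 + a3 * y ^ 4 + a4 * z ^ 4 + b2 * (x ^ 3 * (y + z)) + b3 * (y ^ 3 * z) +
      c23 * (x * y ^ 3) + c24 * (x * z ^ 3) + c34 * (y * z ^ 3) +
      6 * e1 * (x ^ 2 * y ^ 2 + x ^ 2 * z ^ 2 + y ^ 2 * z ^ 2) + 12 * e1 * (x * y * z * (x + y + z))"
      unfolding e by (simp add: algebra_simps power_numeral_reduce)
    then show ?thesis using D[OF refl, of x y z] by metis
  qed
  note p23 = quartic_residues[of a2 a3 b2 e1 c23] and p24 = quartic_residues[of a2 a4 b2 e1 c24]
    and p34 = quartic_residues[of a3 a4 b3 e1 c34]
  have pts: "a2 mod 5 \<in> {0, 4}" "a3 mod 5 \<in> {0, 4}" "a4 mod 5 \<in> {0, 4}"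
    using D'[of 1 0 0] D'[of 0 1 0] D'[of 0 0 1] by simp_all
  note P23 = p23[OF pts(1,2)] and P24 = p24[OF pts(1,3)] and P34 = p34[OF pts(2,3)]
  have P23: "e1 mod 5 = 0 \<and> (a2 mod 5 = 0 \<and> b2 mod 5 = 0 \<and> c23 mod 5 = 0 \<and> a3 mod 5 = 0 \<or>
      a2 mod 5 = 4 \<and> a3 mod 5 = 0 \<or> a2 mod 5 = 0 \<and> a3 mod 5 = 4) \<or>
    a2 mod 5 = 4 \<and> a3 mod 5 = 4 \<and> (e1 mod 5 = 4 \<and> (b2 mod 5 = 1 \<and> c23 mod 5 = 1 \<or> b2 mod 5 = 4 \<and> c23 mod 5 = 4) \<or>
      e1 mod 5 = 1 \<and> (b2 mod 5 + c23 mod 5 = 5))"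
    using D'[of 1 1 0] D'[of 1 "-1" 0] D'[of 1 2 0] D'[of 1 "-2" 0]
    by (intro P23) (simp_all add: algebra_simps)
  have P24: "e1 mod 5 = 0 \<and> (a2 mod 5 = 0 \<and> b2 mod 5 = 0 \<and> c24 mod 5 = 0 \<and> a4 mod 5 = 0 \<or>
      a2 mod 5 = 4 \<and> a4 mod 5 = 0 \<or> a2 mod 5 = 0 \<and> a4 mod 5 = 4) \<or>
    a2 mod 5 = 4 \<and> a4 mod 5 = 4 \<and> (e1 mod 5 = 4 \<and> (b2 mod 5 = 1 \<and> c24 mod 5 = 1 \<or> b2 mod 5 = 4 \<and> c24 mod 5 = 4) \<or>
      e1 mod 5 = 1 \<and> (b2 mod 5 + c24 mod 5 = 5))"
    using D'[of 1 0 1] D'[of 1 0 "-1"] D'[of 1 0 2] D'[of 1 0 "-2"]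
    by (intro P24) (simp_all add: algebra_simps)
  have P34: "e1 mod 5 = 0 \<and> (a3 mod 5 = 0 \<and> b3 mod 5 = 0 \<and> c34 mod 5 = 0 \<and> a4 mod 5 = 0 \<or>
      a3 mod 5 = 4 \<and> a4 mod 5 = 0 \<or> a3 mod 5 = 0 \<and> a4 mod 5 = 4) \<or>
    a3 mod 5 = 4 \<and> a4 mod 5 = 4 \<and> (e1 mod 5 = 4 \<and> (b3 mod 5 = 1 \<and> c34 mod 5 = 1 \<or> b3 mod 5 = 4 \<and> c34 mod 5 = 4) \<or>
      e1 mod 5 = 1 \<and> (b3 mod 5 + c34 mod 5 = 5))"
    using D'[of 0 1 1] D'[of 0 1 "-1"] D'[of 0 1 2] D'[of 0 1 "-2"]
    by (intro P34) (simp_all add: algebra_simps)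
  have q1: "(a2 + a3 + a4 + 2 * b2 + b3 + c23 + c24 + c34 + 54 * e1) mod 5 \<in> {0, 4}"
    using D'[of 1 1 1] by (simp add: algebra_simps)
  have q2: "(a2 + a3 + a4 - b3 - c23 + c24 - c34 + 6 * e1) mod 5 \<in> {0, 4}"
    using D'[of 1 "-1" 1] by (simp add: algebra_simps)
  have sums: "(a2 + a3 + a4 + 2 * b2 + b3 + c23 + c24 + c34 + 54 * e1) mod 5 =
      (a2 mod 5 + a3 mod 5 + a4 mod 5 + 2 * (b2 mod 5) + b3 mod 5 + c23 mod 5 + c24 mod 5 +
        c34 mod 5 + 54 * (e1 mod 5)) mod 5"
      "(a2 + a3 + a4 - b3 - c23 + c24 - c34 + 6 * e1) mod 5 =
      (a2 mod 5 + a3 mod 5 + a4 mod 5 - b3 mod 5 - c23 mod 5 + c24 mod 5 -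
        c34 mod 5 + 6 * (e1 mod 5)) mod 5"
      by (intro mod_add_cong mod_diff_cong mod_mult_cong refl; simp)+
  consider "e1 mod 5 = 0" | "e1 mod 5 = 1" | "e1 mod 5 = 4" using P23 by blast
  then show ?thesis
  proof cases
    case 1
    \<comment> \<open>Two of \<open>a2\<close>, \<open>a3\<close>, \<open>a4\<close> agree modulo 5.
      No pair has both residues 4 here, so both are 0 and the binary quartic of that pair
      vanishes.\<close>
    then have "(a2 mod 5 = 0 \<and> b2 mod 5 = 0 \<and> c23 mod 5 = 0 \<and> a3 mod 5 = 0) \<or>
      (a2 mod 5 = 0 \<and> b2 mod 5 = 0 \<and> c24 mod 5 = 0 \<and> a4 mod 5 = 0) \<or>
      (a3 mod 5 = 0 \<and> b3 mod 5 = 0 \<and> c34 mod 5 = 0 \<and> a4 mod 5 = 0)"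
      using P23 P24 P34 by auto
    with 1 show ?thesis
      unfolding vanishes_def def dvd_eq_mod_eq_0 by auto
  next
    case 2
    then have "a2 mod 5 = 4" "a3 mod 5 = 4" "a4 mod 5 = 4" "b2 mod 5 + c23 mod 5 = 5"
      "b2 mod 5 + c24 mod 5 = 5" "b3 mod 5 + c34 mod 5 = 5"
      using P23 P24 P34 by auto
    note r = this 2
    have "a2 mod 5 + a3 mod 5 + a4 mod 5 + 2 * (b2 mod 5) + b3 mod 5 + c23 mod 5 + c24 mod 5 +
        c34 mod 5 + 54 * (e1 mod 5) = a2 mod 5 + a3 mod 5 + a4 mod 5 + (b2 mod 5 + c23 mod 5) +
        (b2 mod 5 + c24 mod 5) + (b3 mod 5 + c34 mod 5) + 54 * (e1 mod 5)"
      by (simp only: mult_2 ac_simps)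
    \<comment> \<open>The value at the point (1, 1, 1) is thus 1 modulo 5, which is
      excluded.\<close>
    also have "\<dots> = 81" unfolding r by simp
    finally have *: "a2 mod 5 + a3 mod 5 + a4 mod 5 + 2 * (b2 mod 5) + b3 mod 5 + c23 mod 5 + c24 mod 5 +
        c34 mod 5 + 54 * (e1 mod 5) = 81" .
    from q1 show ?thesis unfolding sums * by simp
  next
    case 3
    have R23: "a2 mod 5 = 4 \<and> a3 mod 5 = 4 \<and> (b2 mod 5 = 1 \<and> c23 mod 5 = 1 \<or> b2 mod 5 = 4 \<and> c23 mod 5 = 4)"
      using P23 unfolding 3 by simp
    have R24: "a4 mod 5 = 4 \<and> (b2 mod 5 = 1 \<and> c24 mod 5 = 1 \<or> b2 mod 5 = 4 \<and> c24 mod 5 = 4)"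
      using P24 unfolding 3 by simp
    have R34: "b3 mod 5 = 1 \<and> c34 mod 5 = 1 \<or> b3 mod 5 = 4 \<and> c34 mod 5 = 4"
      using P34 unfolding 3 by simp
    have "b2 mod 5 = 1 \<and> c23 mod 5 = 1 \<and> c24 mod 5 = 1 \<or> b2 mod 5 = 4 \<and> c23 mod 5 = 4 \<and> c24 mod 5 = 4"
      using conjunct2[OF conjunct2[OF R23]] conjunct2[OF R24]
      by (elim disjE conjE; simp)
    note r = conjunct1[OF R23] conjunct1[OF conjunct2[OF R23]] conjunct1[OF R24] this R34 3
    \<comment> \<open>The values at (1, 1, 1) and (1, -1, 1) rule out every alternative involving 4.
      Then the quartic vanishes on the remaining coordinate plane \<open>t = 0\<close>.\<close>
    have "B2 = 1 \<and> C23 = 1 \<and> C24 = 1 \<and> B3 = 1 \<and> C34 = 1"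
      if "B2 = 1 \<and> C23 = 1 \<and> C24 = 1 \<or> B2 = 4 \<and> C23 = 4 \<and> C24 = 4"
        "B3 = 1 \<and> C34 = 1 \<or> B3 = 4 \<and> C34 = 4"
        "(4 + 4 + 4 + 2 * B2 + B3 + C23 + C24 + C34 + 54 * 4) mod 5 \<in> {0, 4}"
        "(4 + 4 + 4 - B3 - C23 + C24 - C34 + 6 * 4) mod 5 \<in> {0, 4}" for B2 C23 C24 B3 C34 :: int
      using that by auto
    note this[OF r(4,5) q1[unfolded sums r(1-3) 3] q2[unfolded sums r(1-3) 3]]
    then have s: "b2 mod 5 = 1 \<and> c23 mod 5 = 1 \<and> c24 mod 5 = 1 \<and> b3 mod 5 = 1 \<and> c34 mod 5 = 1"
      .
    have "vanishes e2 e3 e4 h23 h24 h34"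
      unfolding vanishes_def e using r(1-3) 3 s by (intro conjI; elim conjE; presburger)
    then show ?thesis by blast
  qed
qed

section \<open>Residues of the coefficients\<close>

text \<open>As \<open>s ^ 4\<close> is 1 modulo 5, the assumption confines
  \<open>e + f + s * h\<close> to two classes for all four \<open>s\<close>. If 5 does not divide
  \<open>h\<close>, these are four distinct classes; if it does, \<open>e = f = - 1\<close> would
  give the class of - 2.\<close>

lemma artin_schreier_residues:
  fixes e f h :: int
  assumes "e = 0 \<or> e = - 1" "f = 0 \<or> f = - 1"
    "\<And>s. s \<in> {1, 2, 3, 4} \<Longrightarrow> 5 dvd e * s ^ 4 + f + s * h \<or> 5 dvd e * s ^ 4 + f + s * h + 1"
  shows "5 dvd h \<and> (e = 0 \<or> f = 0)"
proof -
  have *: "\<forall>e\<in>{0, - 1}. \<forall>f\<in>{0, - 1}. \<forall>r\<in>{0, 1, 2, 3, 4 :: int}.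
      (\<forall>s\<in>{1, 2, 3, 4}. (e * s ^ 4 + f + s * r) mod 5 = 0 \<or> (e * s ^ 4 + f + s * r + 1) mod 5 = 0) \<longrightarrow>
      r = 0 \<and> (e = 0 \<or> f = 0)"
    by code_simp
  have "(e * s ^ 4 + f + s * (h mod 5)) mod 5 = (e * s ^ 4 + f + s * h) mod 5"
    "(e * s ^ 4 + f + s * (h mod 5) + 1) mod 5 = (e * s ^ 4 + f + s * h + 1) mod 5" for s
    by (intro mod_add_cong mod_mult_cong refl; simp)+
  with assms(3) have H: "\<forall>s\<in>{1, 2, 3, 4}. (e * s ^ 4 + f + s * (h mod 5)) mod 5 = 0 \<or>
      (e * s ^ 4 + f + s * (h mod 5) + 1) mod 5 = 0"
    unfolding dvd_eq_mod_eq_0 by metis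
  have e: "e \<in> {0, - 1}" and f: "f \<in> {0, - 1}" using assms(1,2) by auto
  have "h mod 5 = 0 \<and> (e = 0 \<or> f = 0)"
    by (rule bspec[OF bspec[OF bspec[OF * e] f] mod_5_cases, THEN mp, OF H])
  then show ?thesis by auto
qed

text \<open>The combination \<open>f 1 - f 2 - f 3 + f 4\<close> of the values cancels the constant
  and linear terms, and the cubic term modulo 5. The quadratic coefficient - 6 contributes - 24, so
  the four values are not all divisible by 5.\<close>

lemma derivative_unit_point:
  fixes k1 k2 k4 :: int
  obtains m :: int where "\<not> 5 dvd k1 + 2 * k2 * m + 3 * (- 2) * m ^ 2 + 4 * k4 * m ^ 3"
proof -
  let ?f = "\<lambda>m. k1 + 2 * k2 * m + 3 * (- 2) * m ^ 2 + 4 * k4 * m ^ 3"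
  have eq: "?f 1 - ?f 2 - ?f 3 + ?f 4 = 5 * (24 * k4 - 5) + 1" by simp
  have "\<not> 5 dvd ?f 1 - ?f 2 - ?f 3 + ?f 4" unfolding eq by presburger
  then have "\<not> (5 dvd ?f 1 \<and> 5 dvd ?f 2 \<and> 5 dvd ?f 3 \<and> 5 dvd ?f 4)"
    by (meson dvd_add dvd_diff)
  then show thesis using that by blast
qed

lemma smul_0 [simp]: "smul 0 x = 0" and smul_1 [simp]: "smul 1 x = x"
  by (auto simp: fun_eq_iff)

context anisotropic_quintic
begin

text \<open>On the line \<open>x p + q\<close> the form is
  \<open>F p * x ^ 5 + E p q * x + F q\<close>, which has no root.\<close>

lemma E_cases:
  assumes "orth {p} q" "nonzero_in n q" "cg (F p) \<alpha>" "integral (F q)"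
  shows "integral (E p q)" "5 dvd \<alpha> \<Longrightarrow> cg (E p q) 0"
    "5 dvd \<alpha> - 1 \<Longrightarrow> cg (E p q) 0 \<or> cg (E p q) (- 1)"
proof -
  have "F p * x ^ 5 + E p q * x + F q \<noteq> 0" for x
    using F_add_nonzero[of "{p}" q "smul x p" 1] F_expand2[of p q x 1] assms
    by (simp add: span_intros mult_ac)
  note no_root_linear[OF this assms(4,3)]
  then show "integral (E p q)" "5 dvd \<alpha> \<Longrightarrow> cg (E p q) 0"
    "5 dvd \<alpha> - 1 \<Longrightarrow> cg (E p q) 0 \<or> cg (E p q) (- 1)"
    by blast+
qed

text \<open>The argument of \<open>E_cases\<close> with \<open>s q + t w\<close> in place of
  \<open>q\<close>: \<open>D\<close> is the coefficient of \<open>x\<close> in \<open>F\<close> at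
  \<open>x p + s q + t w\<close>.\<close>

lemma H_cases:
  fixes s t :: int
  assumes orth: "orth {p} q" "orth {p, q} w" and w: "nonzero_in n w" and F: "cg (F p) \<alpha>"
    and R: "integral (of_int s ^ 5 * F q + of_int t ^ 5 * F w + of_int s * of_int t ^ 4 * E q w)"
    and t: "t \<noteq> 0"
  defines "D \<equiv> E p q * of_int s ^ 4 + E p w * of_int t ^ 4 + of_int s * of_int t ^ 3 * H p q w"
  shows "integral D" "5 dvd \<alpha> \<Longrightarrow> cg D 0" "5 dvd \<alpha> - 1 \<Longrightarrow> cg D 0 \<or> cg D (- 1)"
    "cg (of_int s ^ 5 * F q + of_int t ^ 5 * F w + of_int s * of_int t ^ 4 * E q w) 0 \<Longrightarrow> cg D 0"
proof -
  have "F p * x ^ 5 + D * x +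
      (of_int s ^ 5 * F q + of_int t ^ 5 * F w + of_int s * of_int t ^ 4 * E q w) \<noteq> 0" for x
    using F_add_nonzero[of "{p, q}" w "smul x p + smul (of_int s) q" "of_int t"]
      F_expand3[OF orth, of x "of_int s" "of_int t"] orth w t
    by (simp add: span_intros D_def algebra_simps)
  note no_root_linear[OF this R F]
  then show "integral D" "5 dvd \<alpha> \<Longrightarrow> cg D 0" "5 dvd \<alpha> - 1 \<Longrightarrow> cg D 0 \<or> cg D (- 1)"
    "cg (of_int s ^ 5 * F q + of_int t ^ 5 * F w + of_int s * of_int t ^ 4 * E q w) 0 \<Longrightarrow> cg D 0"
    by blast+
qed

lemma cg_from_sum:
  assumes "cg (x + y + z) k" "cg x a" "cg y b"
  shows "cg z (k - a - b)"
  using cg_diff[OF cg_diff[OF assms(1,2)] assms(3)] by (simp add: algebra_simps)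

lemma H_0_if_divisible:
  assumes "orth {p} q" "orth {p, q} w" "nonzero_in n q" "nonzero_in n w" "cg (F p) 0"
    "cg (F q) 1" "cg (F w) 1"
  shows "cg (H p q w) 0"
proof -
  have pw: "orth {p} w" and qw: "orth {q} w" using assms(2) by (auto elim: orth_subset)
  have int: "integral (F q)" "integral (F w)" using assms cg_imp_integral by blast+
  have E: "cg (E p q) 0" "cg (E p w) 0"
    using E_cases(2)[OF assms(1,3,5) int(1)] E_cases(2)[OF pw assms(4,5) int(2)] by simp_all
  have "integral (of_int 1 ^ 5 * F q + of_int 1 ^ 5 * F w + of_int 1 * of_int 1 ^ 4 * E q w)"
    using E_cases(1)[OF qw assms(4,6) int(2)] int by (intro integral_intros)
  from H_cases(2)[OF assms(1,2,4,5) this]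
  have "cg (E p q + E p w + H p q w) 0" by simp
  from cg_from_sum[OF this E] show ?thesis by simp
qed

text \<open>A pair with \<open>E p q \<equiv> -1\<close> is of Artin--Schreier type \<open>r\<^sup>5 - r s\<^sup>4 + s\<^sup>5\<close>, which has no zero
  modulo 5; a third vector produces one.\<close>

lemma same_class_triple:
  assumes orth: "orth {p} q" "orth {p, q} w"
    and nz: "nonzero_in n q" "nonzero_in n w"
    and F: "cg (F p) 1" "cg (F q) 1" "cg (F w) 1"
  shows "cg (E p q) 0" "cg (H p q w) 0"
proof -
  have pw: "orth {p} w" and qw: "orth {q} w" using orth(2) by (auto elim: orth_subset)
  have int: "integral (F q)" "integral (F w)" using F cg_imp_integral by blast+
  obtain e where e: "cg (E p q) e" "e = 0 \<or> e = - 1"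
    using E_cases(3)[OF orth(1) nz(1) F(1) int(1)] by auto
  obtain f where f: "cg (E p w) f" "f = 0 \<or> f = - 1"
    using E_cases(3)[OF pw nz(2) F(1) int(2)] by auto
  obtain g where g: "cg (E q w) g" "g = 0 \<or> g = - 1"
    using E_cases(3)[OF qw nz(2) F(2) int(2)] by auto
  have R: "integral (of_int s ^ 5 * F q + of_int t ^ 5 * F w + of_int s * of_int t ^ 4 * E q w)" for s t
    using int cg_imp_integral[OF g(1)] by (intro integral_intros)
  note D = H_cases[OF orth nz(2) F(1) R]
  obtain h where h: "cg (H p q w) h"
  proof -
    have "integral (E p q + E p w + H p q w)" using D(1)[of 1 1] by simp
    then obtain k where "cg (E p q + E p w + H p q w) k" by (auto simp: integral_iff_cg)
    from cg_from_sum[OF this e(1) f(1)] show thesis by (rule that)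
  qed
  have D_cg: "cg (E p q * of_int s ^ 4 + E p w * of_int t ^ 4 + of_int s * of_int t ^ 3 * H p q w)
      (e * s ^ 4 + f * t ^ 4 + s * t ^ 3 * h)" for s t
    by (intro cg_intros e f h)
  have "5 dvd h \<and> (e = 0 \<or> f = 0)"
  proof (rule artin_schreier_residues[OF e(2) f(2)])
    fix s :: int
    show "5 dvd e * s ^ 4 + f + s * h \<or> 5 dvd e * s ^ 4 + f + s * h + 1"
      using D(3)[of 1 s] cg_unique[OF D_cg[of s 1]] by fastforce
  qed
  then have h0: "5 dvd h" and ef: "e = 0 \<or> f = 0" by auto
  show "cg (H p q w) 0" using h h0 by (rule cg_dvd_0)
  have "e = 0"
  proof (rule ccontr)
    assume "e \<noteq> 0"
    then have e1: "e = - 1" and f0: "f = 0" using e(2) ef by auto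
    consider "g = 0" | "g = - 1" using g(2) by blast
    then show False
    proof cases
      case 1
      \<comment> \<open>At \<open>q - w\<close> the form is divisible by 5, so the coefficient
        \<open>D\<close> must be divisible by 5, although its residue is \<open>e + f - h\<close>,
        that is - 1.\<close>
      have "cg (of_int 1 ^ 5 * F q + of_int (- 1) ^ 5 * F w + of_int 1 * of_int (- 1) ^ 4 * E q w)
          (1 ^ 5 * 1 + (- 1) ^ 5 * 1 + 1 * (- 1) ^ 4 * 0)"
        using g(1) unfolding 1 by (intro cg_intros F)
      then have "cg (E p q * of_int 1 ^ 4 + E p w * of_int (- 1) ^ 4 +
          of_int 1 * of_int (- 1) ^ 3 * H p q w) 0"
        by (intro D(4)) simp_all
      from cg_unique[OF this D_cg[of 1 "- 1"]] show False
        using h0 unfolding e1 f0 by simp presburger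
    next
      case 2
      \<comment> \<open>Along \<open>- p + x q + w\<close> the constant coefficient is divisible by
        5 and the linear one has residue \<open>g - h\<close>, that is - 1. Hensel's lemma at
        \<open>x = 0\<close> gives a forbidden zero.\<close>
      obtain x where x: "(- F p - E p w + F w) + (E q w - H p q w) * x + 0 * x ^ 2 + 0 * x ^ 3 +
          (- E p q) * x ^ 4 + F q * x ^ 5 = 0"
      proof (rule hensel_quintic[of "- F p - E p w + F w" "E q w - H p q w" 0 0 "- E p q" "F q" 0 "g - h"])
        have "cg (- F p - E p w + F w) (- 1 - f + 1)" by (intro cg_intros F f)
        then show "cg (- F p - E p w + F w + (E q w - H p q w) * of_int 0 + 0 * of_int 0 ^ 2 +
            0 * of_int 0 ^ 3 + - E p q * of_int 0 ^ 4 + F q * of_int 0 ^ 5) 0"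
          by (simp add: f0)
        have "cg (E q w - H p q w) (g - h)" by (intro cg_intros g h)
        then show "cg (E q w - H p q w + 2 * 0 * of_int 0 + 3 * 0 * of_int 0 ^ 2 +
            4 * - E p q * of_int 0 ^ 3) (g - h)"
          by simp
        show "\<not> 5 dvd g - h" using h0 unfolding 2 by presburger
      qed (use F e f g h cg_imp_integral in \<open>auto intro!: integral_intros\<close>)
      then have "F (smul (- 1) p + smul x q + smul 1 w) = 0"
        unfolding F_expand3[OF orth] by (simp add: algebra_simps)
      then show False
        using F_add_nonzero[OF orth(2), of "smul (- 1) p + smul x q" 1] nz(2) by (simp add: span_intros)
    qed
  qed
  then show "cg (E p q) 0" using e(1) by simp
qed

text \<open>On the sublattice \<open>\<Sum> t\<^sub>i \<equiv> 0\<close> of the span of a triple, \<open>F\<close> is divisible by 5; the term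
  \<open>- 2 x\<^sup>3\<close> coming from \<open>(x + 1)\<^sup>5\<close> keeps the derivative of the quotient from vanishing identically.\<close>

lemma plane_quotient:
  assumes orth: "orth {p} q" "orth {p, q} w"
    and F: "cg (F p) 1" "cg (F q) 1" "cg (F w) 1"
    and EH: "cg (E p q) 0" "cg (E p w) 0" "cg (E q w) 0" "cg (H p q w) 0"
  obtains c0 c1 c2 c3 c4 c5 m d where
    "integral c0" "integral c1" "integral c2" "integral c3" "integral c4" "integral c5"
    "cg (c1 + 2 * c2 * of_int m + 3 * c3 * of_int m ^ 2 + 4 * c4 * of_int m ^ 3) d" "\<not> 5 dvd d"
    "\<And>x. F (smul (- (x + 1)) p + smul x q + smul 1 w) =
      5 * (c0 + c1 * x + c2 * x ^ 2 + c3 * x ^ 3 + c4 * x ^ 4 + c5 * x ^ 5)"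
proof -
  have div5: "\<exists>y. integral y \<and> x = 1 + 5 * y" if "cg x 1" for x
  proof -
    have "cg (x - 1) 0" using cg_diff[OF that cg_1] by simp
    then obtain y where "integral y" "x - 1 = 5 * y" by (auto simp: cg_0_iff)
    then show ?thesis by (intro exI[of _ y]) (simp add: algebra_simps)
  qed
  obtain a b c where abc: "integral a" "F p = 1 + 5 * a" "integral b" "F q = 1 + 5 * b"
    "integral c" "F w = 1 + 5 * c"
    using F div5 by metis
  obtain e f g h where efgh: "integral e" "E p q = 5 * e" "integral f" "E p w = 5 * f"
    "integral g" "E q w = 5 * g" "integral h" "H p q w = 5 * h"
    using EH unfolding cg_0_iff by metis
  define c0 c1 c2 c3 c4 c5 where cs: "c0 = c - a - f" "c1 = - (1 + 5 * a) - f + g - h"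
    "c2 = - 2 * (1 + 5 * a) - h" "c3 = - 2 * (1 + 5 * a)" "c4 = - (1 + 5 * a) - e" "c5 = b - a - e"
  have ints: "integral c0" "integral c1" "integral c2" "integral c3" "integral c4" "integral c5"
    unfolding cs using abc efgh by (intro integral_intros; simp)+
  obtain k1 k2 k4 where k: "cg c1 k1" "cg c2 k2" "cg c4 k4"
    using ints by (auto simp: integral_iff_cg)
  have "cg c3 (- 2 * 1)"
    using F(1) unfolding cs abc by (intro cg_intros)
  then have k3: "cg c3 (- 2)" by simp
  obtain m where m: "\<not> 5 dvd k1 + 2 * k2 * m + 3 * (- 2) * m ^ 2 + 4 * k4 * m ^ 3"
    by (rule derivative_unit_point)
  show thesis
  proof (rule that[OF ints _ m])
    show "cg (c1 + 2 * c2 * of_int m + 3 * c3 * of_int m ^ 2 + 4 * c4 * of_int m ^ 3)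
        (k1 + 2 * k2 * m + 3 * (- 2) * m ^ 2 + 4 * k4 * m ^ 3)"
      by (intro cg_intros k k3)
    show "F (smul (- (x + 1)) p + smul x q + smul 1 w) =
        5 * (c0 + c1 * x + c2 * x ^ 2 + c3 * x ^ 3 + c4 * x ^ 4 + c5 * x ^ 5)" for x
      unfolding F_expand3[OF orth] abc efgh cs
      by (simp add: algebra_simps power_numeral_reduce)
  qed
qed

text \<open>\<open>z4\<close> completes triples that make \<open>E z1 z3\<close> and
  \<open>E z2 z3\<close> divisible by 5. If the quotient in \<open>plane_quotient\<close> were
  divisible by 5 at \<open>m\<close>, Hensel's lemma would give a zero of \<open>F\<close>; so
  \<open>F\<close> is 5 times a unit there, and a fifth power normalises the unit.\<close>

lemma next_class_attained:
  assumes orth: "orth {z1} z2" "orth {z1, z2} z3" "orth {z1, z2, z3} z4"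
    and nz: "nonzero_in n z1" "nonzero_in n z2" "nonzero_in n z3" "nonzero_in n z4"
    and F: "cg (F z1) 1" "cg (F z2) 1" "cg (F z3) 1" "cg (F z4) 1"
  obtains u y where "F u = 5 * y" "cg y 1"
proof -
  have sub: "orth {z1} z3" "orth {z2} z3" "orth {z1, z2} z4" "orth {z1, z3} z4" "orth {z2, z3} z4"
    using orth by (auto elim: orth_subset)
  note t = same_class_triple
  have EH: "cg (E z1 z2) 0" "cg (E z1 z3) 0" "cg (E z2 z3) 0" "cg (H z1 z2 z3) 0"
    using t(1)[OF orth(1,2) nz(2,3) F(1-3)] t(2)[OF orth(1,2) nz(2,3) F(1-3)]
      t(1)[OF sub(1,4) nz(3,4) F(1,3,4)] t(1)[OF sub(2,5) nz(3,4) F(2,3,4)] by simp_all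
  obtain c0 c1 c2 c3 c4 c5 m d where
    c: "integral c0" "integral c1" "integral c2" "integral c3" "integral c4" "integral c5"
    and d: "cg (c1 + 2 * c2 * of_int m + 3 * c3 * of_int m ^ 2 + 4 * c4 * of_int m ^ 3) d" "\<not> 5 dvd d"
    and Fx: "\<And>x. F (smul (- (x + 1)) z1 + smul x z2 + smul 1 z3) =
      5 * (c0 + c1 * x + c2 * x ^ 2 + c3 * x ^ 3 + c4 * x ^ 4 + c5 * x ^ 5)"
    by (rule plane_quotient[OF orth(1,2) F(1-3) EH]) (rule that)
  define v where "v = c0 + c1 * of_int m + c2 * of_int m ^ 2 + c3 * of_int m ^ 3 +
    c4 * of_int m ^ 4 + c5 * of_int m ^ 5"
  have "\<not> cg v 0"
  proof
    assume "cg v 0"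
    then obtain x where "c0 + c1 * x + c2 * x ^ 2 + c3 * x ^ 3 + c4 * x ^ 4 + c5 * x ^ 5 = 0"
      using hensel_quintic[OF c _ d] unfolding v_def by blast
    then have "F (smul (- (x + 1)) z1 + smul x z2 + smul 1 z3) = 0" by (simp only: Fx mult_zero_right)
    moreover have "F (smul (- (x + 1)) z1 + smul x z2 + smul 1 z3) \<noteq> 0"
      by (rule F_add_nonzero[OF orth(2) _ nz(3)]) (simp_all add: span_intros)
    ultimately show False by simp
  qed
  moreover have "integral v" unfolding v_def by (intro integral_intros c)
  ultimately obtain w where w: "v = emb w" "\<not> 5 dvd w"
    by (auto simp: integral_def cg_emb)
  obtain l where "l \<noteq> 0" "cg (of_int l ^ 5 * emb w) 1" using w(2) by (rule q5_normalise_unit)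
  moreover have "F (smul (of_int l) (smul (- (of_int m + 1)) z1 + smul (of_int m) z2 + smul 1 z3)) =
      5 * (of_int l ^ 5 * emb w)"
    by (simp only: F_smul Fx v_def[symmetric] w(1)) simp
  ultimately show thesis by (intro that)
qed

text \<open>Adding \<open>s u\<close> to the plane of \<open>plane_quotient\<close> changes the
  quotient by \<open>a s^5 + s Q(x)\<close>, where \<open>vanishes\<close> makes all coefficients of
  the quartic \<open>Q\<close> divisible by 5. Modulo 5 this shifts the constant term freely and
  keeps the derivative, so a simple root can be created at \<open>m\<close>.\<close>

lemma no_vanishing_triple:
  assumes orth: "orth {u} p" "orth {u, p} q" "orth {u, p, q} w"
    and nz: "nonzero_in n w"
    and F: "cg (F p) 1" "cg (F q) 1" "cg (F w) 1"
    and EH: "cg (E p q) 0" "cg (E p w) 0" "cg (E q w) 0" "cg (H p q w) 0"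
    and u: "F u = 5 * a" "cg a 1"
    and e: "E u p = 5 * ep" "E u q = 5 * eq" "E u w = 5 * ew"
      "H u p q = 5 * hpq" "H u p w = 5 * hpw" "H u q w = 5 * hqw"
    and k: "cg ep kp" "cg eq kq" "cg ew kw" "cg hpq kpq" "cg hpw kpw" "cg hqw kqw"
    and van: "vanishes kp kq kw kpq kpw kqw"
  shows False
proof -
  have sub: "orth {p} q" "orth {p, q} w" using orth by (auto elim: orth_subset)
  obtain c0 c1 c2 c3 c4 c5 m d where
    c: "integral c0" "integral c1" "integral c2" "integral c3" "integral c4" "integral c5"
    and d: "cg (c1 + 2 * c2 * of_int m + 3 * c3 * of_int m ^ 2 + 4 * c4 * of_int m ^ 3) d" "\<not> 5 dvd d"
    and Fx: "\<And>x. F (smul (- (x + 1)) p + smul x q + smul 1 w) =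
      5 * (c0 + c1 * x + c2 * x ^ 2 + c3 * x ^ 3 + c4 * x ^ 4 + c5 * x ^ 5)"
    by (rule plane_quotient[OF sub F EH]) (rule that)
  define v where "v = c0 + c1 * of_int m + c2 * of_int m ^ 2 + c3 * of_int m ^ 3 +
    c4 * of_int m ^ 4 + c5 * of_int m ^ 5"
  have "integral v" unfolding v_def by (intro integral_intros c)
  then obtain k where kv: "cg v k" by (auto simp: integral_iff_cg)
  define d0 d1 d2 d3 d4 where ds: "d0 = ep + ew - hpw" "d1 = 4 * ep - hpw + hqw" "d2 = 6 * ep"
    "d3 = 4 * ep - hpq" "d4 = ep + eq - hpq"
  have "cg d0 (kp + kw - kpw)" "cg d1 (4 * kp - kpw + kqw)" "cg d2 (6 * kp)" "cg d3 (4 * kp - kpq)"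
    "cg d4 (kp + kq - kpq)"
    unfolding ds by (intro cg_intros k)+
  then have d': "cg d0 0" "cg d1 0" "cg d2 0" "cg d3 0" "cg d4 0"
    using van unfolding vanishes_def by (auto intro: cg_dvd_0)
  \<comment> \<open>\<open>k\<close> is the residue of the quotient at \<open>m\<close>, and
    \<open>s ^ 5\<close> is congruent to \<open>s\<close>.\<close>
  define s :: q5 where "s = of_int (- k)"
  have s: "cg s (- k)" unfolding s_def by (rule cg_of_int)
  have Fs: "F (smul s u + smul (- (x + 1)) p + smul x q + smul 1 w) =
      5 * ((c0 + a * s ^ 5 + s * d0) + (c1 + s * d1) * x + (c2 + s * d2) * x ^ 2 +
        (c3 + s * d3) * x ^ 3 + (c4 + s * d4) * x ^ 4 + c5 * x ^ 5)" for x
  proof -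
    have "F (smul s u + smul (- (x + 1)) p + smul x q + smul 1 w) =
        F (smul (- (x + 1)) p + smul x q + smul 1 w) + 5 * (a * s ^ 5 + s * d0 + s * d1 * x +
        s * d2 * x ^ 2 + s * d3 * x ^ 3 + s * d4 * x ^ 4)"
      unfolding F_expand4[OF orth] F_expand3[OF sub] u e ds
      by (simp add: algebra_simps power_numeral_reduce)
    then show ?thesis unfolding Fx by (simp add: algebra_simps)
  qed
  obtain x where "(c0 + a * s ^ 5 + s * d0) + (c1 + s * d1) * x + (c2 + s * d2) * x ^ 2 +
        (c3 + s * d3) * x ^ 3 + (c4 + s * d4) * x ^ 4 + c5 * x ^ 5 = 0"
  proof (rule hensel_quintic[of "c0 + a * s ^ 5 + s * d0" "c1 + s * d1" "c2 + s * d2" "c3 + s * d3"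
        "c4 + s * d4" c5 m d])
    have "cg (v + a * s ^ 5 + s * d0 + s * d1 * of_int m + s * d2 * of_int m ^ 2 +
        s * d3 * of_int m ^ 3 + s * d4 * of_int m ^ 4)
        (k + 1 * (- k) ^ 5 + (- k) * 0 + (- k) * 0 * m + (- k) * 0 * m ^ 2 + (- k) * 0 * m ^ 3 + (- k) * 0 * m ^ 4)"
      by (intro cg_intros kv u s d')
    moreover have "5 dvd k + (- k) ^ 5"
      using pow5_mod5[of k] dvd_diff_commute[of 5 "k ^ 5" k] by simp
    ultimately have "cg (v + a * s ^ 5 + s * d0 + s * d1 * of_int m + s * d2 * of_int m ^ 2 +
        s * d3 * of_int m ^ 3 + s * d4 * of_int m ^ 4) 0"
      by (intro cg_dvd_0) simp_all
    then show "cg (c0 + a * s ^ 5 + s * d0 + (c1 + s * d1) * of_int m + (c2 + s * d2) * of_int m ^ 2 +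
        (c3 + s * d3) * of_int m ^ 3 + (c4 + s * d4) * of_int m ^ 4 + c5 * of_int m ^ 5) 0"
      by (simp add: v_def algebra_simps)
    have "cg ((c1 + 2 * c2 * of_int m + 3 * c3 * of_int m ^ 2 + 4 * c4 * of_int m ^ 3) +
        s * d1 + 2 * (s * d2) * of_int m + 3 * (s * d3) * of_int m ^ 2 + 4 * (s * d4) * of_int m ^ 3)
        (d + (- k) * 0 + 2 * ((- k) * 0) * m + 3 * ((- k) * 0) * m ^ 2 + 4 * ((- k) * 0) * m ^ 3)"
      by (intro cg_intros d s d')
    then show "cg (c1 + s * d1 + 2 * (c2 + s * d2) * of_int m + 3 * (c3 + s * d3) * of_int m ^ 2 +
        4 * (c4 + s * d4) * of_int m ^ 3) d"
      by (simp add: algebra_simps)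
  qed (use c d d' u s cg_imp_integral in \<open>auto intro!: integral_intros\<close>)
  then have "F (smul s u + smul (- (x + 1)) p + smul x q + smul 1 w) = 0"
    by (simp only: Fs mult_zero_right)
  moreover have "F (smul s u + smul (- (x + 1)) p + smul x q + smul 1 w) \<noteq> 0"
    by (rule F_add_nonzero[OF orth(3) _ nz]) (simp_all add: span_intros)
  ultimately show False by simp
qed

end

section \<open>Chains of orthogonal vectors and the bound\<close>

context anisotropic_quintic
begin

text \<open>\<open>z5\<close> completes the triples that make every \<open>E\<close> among
  \<open>z1\<close> to \<open>z4\<close> divisible by 5. If the coefficients \<open>t\<close>,
  \<open>x\<close>, \<open>y\<close>, \<open>z\<close> of these vectors sum to 0, then
  \<open>F (V s) / 5\<close> has the form \<open>a * s ^ 5 + D * s + R'\<close> without roots, so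
  \<open>D\<close> is 0 or - 1 modulo 5. As a function of the coefficients \<open>D\<close> is the
  quartic treated above, and a triple on which it vanishes is impossible.\<close>

lemma no_long_chain:
  assumes orth: "orth {u} z1" "orth {u, z1} z2" "orth {u, z1, z2} z3" "orth {u, z1, z2, z3} z4"
      "orth {u, z1, z2, z3, z4} z5"
    and nz: "nonzero_in n z1" "nonzero_in n z2" "nonzero_in n z3" "nonzero_in n z4" "nonzero_in n z5"
    and F: "cg (F z1) 1" "cg (F z2) 1" "cg (F z3) 1" "cg (F z4) 1" "cg (F z5) 1"
    and u: "F u = 5 * a" "cg a 1"
  shows False
proof -
  have sub: "orth {u} z2" "orth {u} z3" "orth {u} z4"
    "orth {u, z1} z3" "orth {u, z1} z4" "orth {u, z2} z3" "orth {u, z2} z4" "orth {u, z3} z4"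
    "orth {u, z1, z2} z4" "orth {u, z1, z3} z4" "orth {u, z2, z3} z4"
    using orth by (auto elim: orth_subset)
  have sub': "orth {z1} z2" "orth {z1} z3" "orth {z1} z4" "orth {z2} z3" "orth {z2} z4" "orth {z3} z4"
    "orth {z1, z2} z3" "orth {z1, z2} z4" "orth {z1, z3} z4" "orth {z2, z3} z4"
    "orth {z1, z2} z5" "orth {z1, z3} z5" "orth {z1, z4} z5" "orth {z2, z3} z5" "orth {z2, z4} z5"
    "orth {z3, z4} z5"
    using orth by (auto elim: orth_subset)
  have E0: "cg (E z1 z2) 0" "cg (E z1 z3) 0" "cg (E z1 z4) 0" "cg (E z2 z3) 0" "cg (E z2 z4) 0"
    "cg (E z3 z4) 0"
    using same_class_triple(1)[OF sub'(1,11) nz(2,5) F(1,2,5)]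
      same_class_triple(1)[OF sub'(2,12) nz(3,5) F(1,3,5)]
      same_class_triple(1)[OF sub'(3,13) nz(4,5) F(1,4,5)]
      same_class_triple(1)[OF sub'(4,14) nz(3,5) F(2,3,5)]
      same_class_triple(1)[OF sub'(5,15) nz(4,5) F(2,4,5)]
      same_class_triple(1)[OF sub'(6,16) nz(4,5) F(3,4,5)] by simp_all
  have H0: "cg (H z1 z2 z3) 0" "cg (H z1 z2 z4) 0" "cg (H z1 z3 z4) 0" "cg (H z2 z3 z4) 0"
    using same_class_triple(2)[OF sub'(1,7) nz(2,3) F(1,2,3)]
      same_class_triple(2)[OF sub'(1,8) nz(2,4) F(1,2,4)]
      same_class_triple(2)[OF sub'(2,9) nz(3,4) F(1,3,4)]
      same_class_triple(2)[OF sub'(4,10) nz(3,4) F(2,3,4)] by simp_all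
  have u0: "cg (F u) 0" using u cg_imp_integral by (auto simp: cg_0_iff)
  note int = F[THEN cg_imp_integral]
  have Eu: "cg (E u z1) 0" "cg (E u z2) 0" "cg (E u z3) 0" "cg (E u z4) 0"
    using E_cases(2)[OF orth(1) nz(1) u0 int(1)] E_cases(2)[OF sub(1) nz(2) u0 int(2)]
      E_cases(2)[OF sub(2) nz(3) u0 int(3)] E_cases(2)[OF sub(3) nz(4) u0 int(4)] by simp_all
  have Hu: "cg (H u z1 z2) 0" "cg (H u z1 z3) 0" "cg (H u z1 z4) 0" "cg (H u z2 z3) 0"
    "cg (H u z2 z4) 0" "cg (H u z3 z4) 0"
    using H_0_if_divisible[OF orth(1,2) nz(1,2) u0 F(1,2)]
      H_0_if_divisible[OF orth(1) sub(4) nz(1,3) u0 F(1,3)]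
      H_0_if_divisible[OF orth(1) sub(5) nz(1,4) u0 F(1,4)]
      H_0_if_divisible[OF sub(1,6) nz(2,3) u0 F(2,3)]
      H_0_if_divisible[OF sub(1,7) nz(2,4) u0 F(2,4)]
      H_0_if_divisible[OF sub(2,8) nz(3,4) u0 F(3,4)] by simp_all
  have div5: "\<exists>y k. x = 5 * y \<and> cg y k" if "cg x 0" for x
    using that by (auto simp: cg_0_iff integral_iff_cg)
  obtain e1 k1 where e1: "E u z1 = 5 * e1" "cg e1 k1" using div5[OF Eu(1)] by blast
  obtain e2 k2 where e2: "E u z2 = 5 * e2" "cg e2 k2" using div5[OF Eu(2)] by blast
  obtain e3 k3 where e3: "E u z3 = 5 * e3" "cg e3 k3" using div5[OF Eu(3)] by blast
  obtain e4 k4 where e4: "E u z4 = 5 * e4" "cg e4 k4" using div5[OF Eu(4)] by blast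
  obtain h12 l12 where h12: "H u z1 z2 = 5 * h12" "cg h12 l12" using div5[OF Hu(1)] by blast
  obtain h13 l13 where h13: "H u z1 z3 = 5 * h13" "cg h13 l13" using div5[OF Hu(2)] by blast
  obtain h14 l14 where h14: "H u z1 z4 = 5 * h14" "cg h14 l14" using div5[OF Hu(3)] by blast
  obtain h23 l23 where h23: "H u z2 z3 = 5 * h23" "cg h23 l23" using div5[OF Hu(4)] by blast
  obtain h24 l24 where h24: "H u z2 z4 = 5 * h24" "cg h24 l24" using div5[OF Hu(5)] by blast
  obtain h34 l34 where h34: "H u z3 z4 = 5 * h34" "cg h34 l34" using div5[OF Hu(6)] by blast
  note res = e1(2) e2(2) e3(2) e4(2) h12(2) h13(2) h14(2) h23(2) h24(2) h34(2)
  have "vanishes k1 k2 k3 l12 l13 l23 \<or> vanishes k1 k2 k4 l12 l14 l24 \<or>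
    vanishes k1 k3 k4 l13 l14 l34 \<or> vanishes k2 k3 k4 l23 l24 l34"
  proof (rule quartic_vanishes_on_coordinate_plane)
    fix t x y z :: int
    assume t: "t = - (x + y + z)"
    let ?k = "k1 * t ^ 4 + k2 * x ^ 4 + k3 * y ^ 4 + k4 * z ^ 4 + l12 * (t * x ^ 3) +
      l13 * (t * y ^ 3) + l14 * (t * z ^ 3) + l23 * (x * y ^ 3) + l24 * (x * z ^ 3) + l34 * (y * z ^ 3)"
    show "?k mod 5 \<in> {0, 4}"
    proof (cases "x = 0 \<and> y = 0 \<and> z = 0")
      case True
      then show ?thesis using t by simp
    next
      case False
      define D where "D = e1 * of_int t ^ 4 + e2 * of_int x ^ 4 + e3 * of_int y ^ 4 +
        e4 * of_int z ^ 4 + h12 * (of_int t * of_int x ^ 3) + h13 * (of_int t * of_int y ^ 3) +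
        h14 * (of_int t * of_int z ^ 3) + h23 * (of_int x * of_int y ^ 3) +
        h24 * (of_int x * of_int z ^ 3) + h34 * (of_int y * of_int z ^ 3)"
      have D: "cg D ?k" unfolding D_def by (intro cg_intros res)
      define V where "V s = smul s u + smul (of_int t) z1 + smul (of_int x) z2 +
        smul (of_int y) z3 + smul (of_int z) z4" for s
      have V: "F (V s) \<noteq> 0" for s
      proof -
        \<comment> \<open>The last non-zero coefficient selects the orthogonality to use;
          \<open>t\<close> cannot be the only one, being \<open>- (x + y + z)\<close>.\<close>
        consider "z \<noteq> 0" | "z = 0" "y \<noteq> 0" | "z = 0" "y = 0" "x \<noteq> 0" using False by blast
        then show ?thesis
        proof cases
          case 1
          then show ?thesis
            unfolding V_def by (intro F_add_nonzero[OF orth(4)] nz span_intros) simp_all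
        next
          case 2
          then have "F (smul s u + smul (of_int t) z1 + smul (of_int x) z2 + smul (of_int y) z3) \<noteq> 0"
            by (intro F_add_nonzero[OF orth(3)] nz span_intros) simp_all
          then show ?thesis using 2 by (simp add: V_def)
        next
          case 3
          then have "F (smul s u + smul (of_int t) z1 + smul (of_int x) z2) \<noteq> 0"
            by (intro F_add_nonzero[OF orth(2)] nz span_intros) simp_all
          then show ?thesis using 3 by (simp add: V_def)
        qed
      qed
      define R where "R = of_int t ^ 5 * F z1 + of_int x ^ 5 * F z2 + of_int y ^ 5 * F z3 +
        of_int z ^ 5 * F z4 + (of_int t * of_int x ^ 4 * E z1 z2 + of_int t * of_int y ^ 4 * E z1 z3 +
        of_int t * of_int z ^ 4 * E z1 z4 + of_int x * of_int y ^ 4 * E z2 z3 +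
        of_int x * of_int z ^ 4 * E z2 z4 + of_int y * of_int z ^ 4 * E z3 z4 +
        of_int t * of_int x * of_int y ^ 3 * H z1 z2 z3 + of_int t * of_int x * of_int z ^ 3 * H z1 z2 z4 +
        of_int t * of_int y * of_int z ^ 3 * H z1 z3 z4 + of_int x * of_int y * of_int z ^ 3 * H z2 z3 z4)"
      have "cg R (t ^ 5 * 1 + x ^ 5 * 1 + y ^ 5 * 1 + z ^ 5 * 1 + (t * x ^ 4 * 0 + t * y ^ 4 * 0 +
        t * z ^ 4 * 0 + x * y ^ 4 * 0 + x * z ^ 4 * 0 + y * z ^ 4 * 0 + t * x * y ^ 3 * 0 +
        t * x * z ^ 3 * 0 + t * y * z ^ 3 * 0 + x * y * z ^ 3 * 0))"
        unfolding R_def by (intro cg_intros F E0 H0)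
      moreover have "5 dvd (t ^ 5 - t) + (x ^ 5 - x) + (y ^ 5 - y) + (z ^ 5 - z)"
        by (intro dvd_add pow5_mod5)
      then have "5 dvd t ^ 5 + x ^ 5 + y ^ 5 + z ^ 5" by (simp add: t algebra_simps)
      ultimately have "cg R 0" by (intro cg_dvd_0) simp_all
      then obtain R' where R': "integral R'" "R = 5 * R'" by (auto simp: cg_0_iff)
      have "F (V s) = s ^ 5 * F u + 5 * (s * D) + R" for s
        unfolding V_def F_expand5[OF orth(1-4)] e1 e2 e3 e4 h12 h13 h14 h23 h24 h34 R_def D_def
        by (simp only: algebra_simps)
      then have FV: "F (V s) = 5 * (a * s ^ 5 + D * s + R')" for s
        unfolding u R' by (simp add: algebra_simps)
      then have "a * s ^ 5 + D * s + R' \<noteq> 0" for s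
        using V[of s] by (metis FV mult_zero_right)
      from no_root_linear(3)[OF this R'(1) u(2)]
      have "cg D 0 \<or> cg D (- 1)" by simp
      then have "5 dvd ?k - 0 \<or> 5 dvd ?k - - 1" using cg_unique[OF D] by blast
      moreover have "j mod 5 \<in> {0, 4}" if "5 dvd j - 0 \<or> 5 dvd j - - 1" for j :: int
        using that by (simp, presburger)
      ultimately show ?thesis by blast
    qed
  qed
  then show False
    using no_vanishing_triple[OF orth(1-3) nz(3) F(1,2,3) E0(1,2,4) H0(1) u
        e1(1) e2(1) e3(1) h12(1) h13(1) h23(1) e1(2) e2(2) e3(2) h12(2) h13(2) h23(2)]
      no_vanishing_triple[OF orth(1,2) sub(9) nz(4) F(1,2,4) E0(1,3,5) H0(2) u
        e1(1) e2(1) e4(1) h12(1) h14(1) h24(1) e1(2) e2(2) e4(2) h12(2) h14(2) h24(2)]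
      no_vanishing_triple[OF orth(1) sub(4,10) nz(4) F(1,3,4) E0(2,3,6) H0(3) u
        e1(1) e3(1) e4(1) h13(1) h14(1) h34(1) e1(2) e3(2) e4(2) h13(2) h14(2) h34(2)]
      no_vanishing_triple[OF sub(1,6,11) nz(4) F(2,3,4) E0(4,5,6) H0(4) u
        e2(1) e3(1) e4(1) h23(1) h24(1) h34(1) e2(2) e3(2) e4(2) h23(2) h24(2) h34(2)]
    by blast
qed

text \<open>Otherwise any five vectors have an orthogonal successor with value congruent to 1. Four
  successive choices produce some \<open>u\<close> in the next class, and five more after
  \<open>u\<close> contradict \<open>no_long_chain\<close>.\<close>

lemma unit_class_avoided:
  obtains g where "length g = 5"
    "\<And>x. nonzero_in n x \<Longrightarrow> orth (set g) x \<Longrightarrow> \<not> cg (F x) 1"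
proof (rule ccontr)
  assume "\<not> thesis"
  then have ex: "\<exists>x. nonzero_in n x \<and> orth (set g) x \<and> cg (F x) 1" if "length g = 5" for g
    using that \<open>\<And>g. \<lbrakk>length g = 5; \<And>x. nonzero_in n x \<Longrightarrow> orth (set g) x \<Longrightarrow> \<not> cg (F x) 1\<rbrakk> \<Longrightarrow> thesis\<close>
    by blast
  have no: "F u \<noteq> 5 * y" if y: "cg y 1" for u y
  proof
    assume u: "F u = 5 * y"
    \<comment> \<open>Repeated entries pad the lists to length 5 without changing their
      sets.\<close>
    obtain z1 where z1: "nonzero_in n z1" "orth {u} z1" "cg (F z1) 1"
      using ex[of "[u, u, u, u, u]"] by auto
    obtain z2 where z2: "nonzero_in n z2" "orth {u, z1} z2" "cg (F z2) 1"
      using ex[of "[u, u, u, u, z1]"] by auto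
    obtain z3 where z3: "nonzero_in n z3" "orth {u, z1, z2} z3" "cg (F z3) 1"
      using ex[of "[u, u, u, z1, z2]"] by auto
    obtain z4 where z4: "nonzero_in n z4" "orth {u, z1, z2, z3} z4" "cg (F z4) 1"
      using ex[of "[u, u, z1, z2, z3]"] by auto
    obtain z5 where z5: "nonzero_in n z5" "orth {u, z1, z2, z3, z4} z5" "cg (F z5) 1"
      using ex[of "[u, z1, z2, z3, z4]"] by auto
    show False
      by (rule no_long_chain[OF z1(2) z2(2) z3(2) z4(2) z5(2) z1(1) z2(1) z3(1) z4(1) z5(1)
        z1(3) z2(3) z3(3) z4(3) z5(3) u y])
  qed
  obtain z1 where z1: "nonzero_in n z1" "cg (F z1) 1"
    using ex[of "replicate 5 undefined"] by auto
  obtain z2 where z2: "nonzero_in n z2" "orth {z1} z2" "cg (F z2) 1"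
    using ex[of "[z1, z1, z1, z1, z1]"] by auto
  obtain z3 where z3: "nonzero_in n z3" "orth {z1, z2} z3" "cg (F z3) 1"
    using ex[of "[z1, z1, z1, z1, z2]"] by auto
  obtain z4 where z4: "nonzero_in n z4" "orth {z1, z2, z3} z4" "cg (F z4) 1"
    using ex[of "[z1, z1, z1, z2, z3]"] by auto
  obtain u y where "F u = 5 * y" "cg y 1"
    by (rule next_class_attained[OF z2(2) z3(2) z4(2) z1(1) z2(1) z3(1) z4(1) z1(2) z2(3) z3(3) z4(3)])
  then show False using no by blast
qed

lemma scaled:
  assumes "k \<noteq> 0"
  shows "anisotropic_quintic n (\<lambda>a b c d e. k * M a b c d e)"
proof
  show "linear_form (\<lambda>x. k * M x b c d e)" for b c d e
    using linear1[of b c d e] by (simp add: linear_form_def algebra_simps)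
qed (use assms swap12 swap23 swap34 swap45 null anisotropic in \<open>auto simp: mult_left_cancel\<close>)

text \<open>Dividing \<open>M\<close> by \<open>5 ^ c\<close> moves the class \<open>c\<close> to
  the units and preserves orthogonality.\<close>

lemma class_avoided:
  obtains g where "length g = 5"
    "\<And>x y. nonzero_in n x \<Longrightarrow> orth (set g) x \<Longrightarrow> cg y 1 \<Longrightarrow> F x \<noteq> 5 ^ c * y"
proof -
  interpret S: anisotropic_quintic n "\<lambda>a b c d e. inverse (5 ^ m) * M a b c d e" for m :: nat
    by (rule scaled) simp
  have orth: "S.orth c = orth"
    by (intro ext) (simp add: S.orth_def orth_def)
  have SF: "S.F c x = inverse (5 ^ c) * F x" for x by (simp add: S.F_def F_def)
  obtain g where g: "length g = 5" "\<And>x. nonzero_in n x \<Longrightarrow> orth (set g) x \<Longrightarrow> \<not> cg (S.F c x) 1"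
    using S.unit_class_avoided[of c] unfolding orth by blast
  show thesis
  proof (rule that[OF g(1)])
    fix x y assume "nonzero_in n x" "orth (set g) x" and y: "cg y 1"
    then have "\<not> cg (inverse (5 ^ c) * F x) 1" using g(2) SF by metis
    moreover have "inverse (5 ^ c) * (5 ^ c * y) = y" by (simp add: field_simps)
    ultimately show "F x \<noteq> 5 ^ c * y" using y by metis
  qed
qed

text \<open>Five avoiding vectors for each of five classes give \<open>5 * 5\<close> cubic,
  \<open>5 * 15 * 5\<close> quadratic and \<open>5 * 5 ^ 4\<close> linear conditions. A common zero
  would avoid every class, yet \<open>q5_normalise\<close> places a multiple of it in one.\<close>

lemma not_solvable: "\<not> solvable n 25 375 3125"
proof
  assume sol: "solvable n 25 375 3125"
  have "\<forall>c. \<exists>g. length g = 5 \<and>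
      (\<forall>x y. nonzero_in n x \<longrightarrow> orth (set g) x \<longrightarrow> cg y 1 \<longrightarrow> F x \<noteq> 5 ^ c * y)"
    using class_avoided by metis
  then obtain g where g: "\<And>c. length (g c) = 5"
    "\<And>c x y. nonzero_in n x \<Longrightarrow> orth (set (g c)) x \<Longrightarrow> cg y 1 \<Longrightarrow> F x \<noteq> 5 ^ c * y"
    by metis
  let ?I = "[0..<5]"
  \<comment> \<open>The 15 index pairs up to order; symmetry of \<open>M\<close> in its first two
    arguments covers the reversed pairs.\<close>
  define P where "P = concat (map (\<lambda>i. map (Pair i) [0..<Suc i]) ?I)"
  have P: "length P = 15" by (simp add: P_def upt_rec)
  have P_mem: "(i, j) \<in> set P \<or> (j, i) \<in> set P" if "i < 5" "j < 5" for i j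
  proof -
    have "(i, j) \<in> set P \<longleftrightarrow> i < 5 \<and> j \<le> i" for i j
      by (auto simp: P_def image_iff)
    with that show ?thesis by (meson linear)
  qed
  define Cs where "Cs = map (\<lambda>(c, i). M (g c ! i) (g c ! i)) (List.product ?I ?I)"
  define Qs where "Qs = map (\<lambda>(c, (i, j), k). M (g c ! i) (g c ! j) (g c ! k))
    (List.product ?I (List.product P ?I))"
  define Ls where "Ls = map (\<lambda>(c, i, j, k, l). M (g c ! i) (g c ! j) (g c ! k) (g c ! l))
    (List.product ?I (List.product ?I (List.product ?I (List.product ?I ?I))))"
  have bil: "bilinear_form (M a b c)" for a b c
    unfolding bilinear_form_def using linear4 swap45 by blast
  have tril: "trilinear_form (M a b)" for a b
    unfolding trilinear_form_def using linear3 swap34 swap45 by blast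
  obtain x where x: "nonzero_in n x" "\<And>C. C \<in> set Cs \<Longrightarrow> C x x x = 0"
    "\<And>B. B \<in> set Qs \<Longrightarrow> B x x = 0" "\<And>L. L \<in> set Ls \<Longrightarrow> L x = 0"
  proof (rule solvableD[OF sol, of Cs Qs Ls])
    show "trilinear_form C" if "C \<in> set Cs" for C using that tril by (auto simp: Cs_def)
    show "bilinear_form B" if "B \<in> set Qs" for B using that bil by (auto simp: Qs_def)
    show "linear_form L" if "L \<in> set Ls" for L using that linear5 by (auto simp: Ls_def)
    show "length Cs \<le> 25" "length Qs \<le> 375" "length Ls \<le> 3125"
      by (simp_all add: Cs_def Qs_def Ls_def P)
  qed (rule that)
  have orth: "orth (set (g c)) x" if c: "c < 5" for c
  proof -
    have idx: "\<exists>i<5. a = g c ! i" if "a \<in> set (g c)" for a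
      using that g(1)[of c] by (metis in_set_conv_nth)
    have "M a1 a2 a3 a4 x = 0" if a: "a1 \<in> set (g c)" "a2 \<in> set (g c)" "a3 \<in> set (g c)" "a4 \<in> set (g c)"
      for a1 a2 a3 a4
    proof -
      obtain i j k l where "i < 5" "j < 5" "k < 5" "l < 5"
        "a1 = g c ! i" "a2 = g c ! j" "a3 = g c ! k" "a4 = g c ! l"
        using idx[OF a(1)] idx[OF a(2)] idx[OF a(3)] idx[OF a(4)] by blast
      then show ?thesis
        using c x(4)[unfolded Ls_def set_map, OF imageI, of "(c, i, j, k, l)"] by simp
    qed
    moreover have "M a1 a2 a3 x x = 0" if a: "a1 \<in> set (g c)" "a2 \<in> set (g c)" "a3 \<in> set (g c)"
      for a1 a2 a3
    proof -
      obtain i j k where ijk: "i < 5" "j < 5" "k < 5" "a1 = g c ! i" "a2 = g c ! j" "a3 = g c ! k"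
        using idx[OF a(1)] idx[OF a(2)] idx[OF a(3)] by blast
      have "M (g c ! i') (g c ! j') (g c ! k) x x = 0" if "(i', j') \<in> set P" for i' j'
        using c ijk(3) that x(3)[unfolded Qs_def set_map, OF imageI, of "(c, (i', j'), k)"] by simp
      then show ?thesis
        using P_mem[OF ijk(1,2)] swap12[of a1 a2 a3 x x] unfolding ijk(4-6) by metis
    qed
    moreover have "M a a x x x = 0" if a: "a \<in> set (g c)" for a
    proof -
      obtain i where "i < 5" "a = g c ! i" using idx[OF a] by blast
      then show ?thesis
        using c x(2)[unfolded Cs_def set_map, OF imageI, of "(c, i)"] by simp
    qed
    ultimately show ?thesis unfolding orth_def by blast
  qed
  have "F x \<noteq> 0" using x(1) anisotropic by (simp add: F_def)
  then obtain c y l where l: "c < 5" "cg y 1" "l \<noteq> 0" "l ^ 5 * F x = 5 ^ c * y"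
    by (rule q5_normalise)
  have "nonzero_in n (smul l x)" using x(1) l(3) by (auto simp: nonzero_in_def)
  then have "F (smul l x) \<noteq> 5 ^ c * y" using orth[OF l(1)] l(2) g(2) orth_smul by blast
  then show False using l(4) by (simp add: F_smul)
qed

end

section \<open>From quintic polynomials to symmetric 5-linear forms\<close>

lemma prod_power_eq_prod_list:
  fixes f :: "'b \<Rightarrow> nat"
  assumes "finite A"
  shows "\<exists>xs. length xs = (\<Sum>i\<in>A. f i) \<and> set xs \<subseteq> A \<and>
    (\<forall>x :: 'b \<Rightarrow> 'a::comm_monoid_mult. (\<Prod>i\<in>A. x i ^ f i) = prod_list (map x xs))"
  using assms
proof (induction A)
  case empty
  show ?case by (intro exI[of _ "[]"]) simp
next
  case (insert a A)
  then obtain xs where "length xs = (\<Sum>i\<in>A. f i)" "set xs \<subseteq> A"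
    "\<forall>x :: 'b \<Rightarrow> 'a. (\<Prod>i\<in>A. x i ^ f i) = prod_list (map x xs)" by blast
  with insert.hyps show ?case
    by (intro exI[of _ "replicate (f a) a @ xs"]) auto
qed

text \<open>The symmetric 5-linear form below restricts to \<open>120\<close> times the given quintic on the diagonal.\<close>

lemma polarisation:
  fixes G :: "q5 mpoly"
  assumes form: "is_form n 5 G" and no_zero: "\<not> has_nontrivial_zero n G"
  obtains M where "anisotropic_quintic n M"
proof -
  let ?K = "Poly_Mapping.keys G" and ?c = "Poly_Mapping.lookup G"
  have "\<forall>m. \<exists>xs. m \<in> ?K \<longrightarrow> length xs = 5 \<and> set xs \<subseteq> {..<n} \<and>
      (\<forall>x :: vec. (\<Prod>i\<in>Poly_Mapping.keys m. x i ^ Poly_Mapping.lookup m i) = prod_list (map x xs))"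
  proof
    fix m
    show "\<exists>xs. m \<in> ?K \<longrightarrow> length xs = 5 \<and> set xs \<subseteq> {..<n} \<and>
      (\<forall>x :: vec. (\<Prod>i\<in>Poly_Mapping.keys m. x i ^ Poly_Mapping.lookup m i) = prod_list (map x xs))"
      using form prod_power_eq_prod_list[of "Poly_Mapping.keys m" "Poly_Mapping.lookup m", where ?'a = q5]
      unfolding is_form_def by (metis finite_keys subset_trans)
  qed
  \<comment> \<open>\<open>I m\<close> lists the variables of the monomial \<open>m\<close> with
    multiplicity, giving five slots over which five vectors can be distributed.\<close>
  from choice[OF this] obtain I where "\<forall>m. m \<in> ?K \<longrightarrow> length (I m) = 5 \<and> set (I m) \<subseteq> {..<n} \<and>
      (\<forall>x :: vec. (\<Prod>i\<in>Poly_Mapping.keys m. x i ^ Poly_Mapping.lookup m i) = prod_list (map x (I m)))"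
    by blast
  then have I: "\<And>m. m \<in> ?K \<Longrightarrow> length (I m) = 5" "\<And>m. m \<in> ?K \<Longrightarrow> set (I m) \<subseteq> {..<n}"
    "\<And>m (x :: vec). m \<in> ?K \<Longrightarrow>
      (\<Prod>i\<in>Poly_Mapping.keys m. x i ^ Poly_Mapping.lookup m i) = prod_list (map x (I m))" by blast+
  define T where "T a b c d e p m = (a (I m ! p 0) * b (I m ! p 1) * c (I m ! p 2) * d (I m ! p 3) *
    e (I m ! p 4) :: q5)" for a b c d e and p :: "nat \<Rightarrow> nat" and m
  define S where "S = {p. p permutes {..<5::nat}}"
  define M where "M a b c d e = (\<Sum>m\<in>?K. ?c m * (\<Sum>p\<in>S. T a b c d e p m))" for a b c d e
  have reindex: "(\<Sum>p\<in>S. f p) = (\<Sum>p\<in>S. f (p \<circ> Transposition.transpose i j))"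
    if "i < 5" "j < 5" for i j and f :: "(nat \<Rightarrow> nat) \<Rightarrow> q5"
    unfolding S_def using that by (intro sum_permutations_compose_right permutes_swap_id) auto
  have "anisotropic_quintic n M"
  proof
    show "linear_form (\<lambda>x. M x b c d e)" for b c d e
      unfolding linear_form_def M_def T_def
      by (simp add: sum.distrib sum_distrib_left distrib_right distrib_left mult_ac)
    show "M a b c d e = M b a c d e" for a b c d e
      unfolding M_def by (subst reindex[of 0 1]) (simp_all add: T_def Transposition.transpose_def mult_ac)
    show "M a b c d e = M a c b d e" for a b c d e
      unfolding M_def by (subst reindex[of 1 2]) (simp_all add: T_def Transposition.transpose_def mult_ac)
    show "M a b c d e = M a b d c e" for a b c d e
      unfolding M_def by (subst reindex[of 2 3]) (simp_all add: T_def Transposition.transpose_def mult_ac)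
    show "M a b c d e = M a b c e d" for a b c d e
      unfolding M_def by (subst reindex[of 3 4]) (simp_all add: T_def Transposition.transpose_def mult_ac)
    show "M x b c d e = 0" if "\<not> nonzero_in n x" for x b c d e
    proof -
      have "x (I m ! p 0) = 0" if "m \<in> ?K" "p \<in> S" for m p
      proof -
        have "p 0 < 5" using that(2) permutes_in_image[of p "{..<5}" 0] by (auto simp: S_def)
        then have "I m ! p 0 \<in> set (I m)" using I(1)[OF that(1)] by simp
        then show ?thesis using I(2)[OF that(1)] \<open>\<not> nonzero_in n x\<close> by (auto simp: nonzero_in_def)
      qed
      then show ?thesis by (simp add: M_def T_def)
    qed
    show "M x x x x x \<noteq> 0" if "nonzero_in n x" for x
    proof -
      have "(\<Sum>p\<in>S. T x x x x x p m) =
          120 * (\<Prod>i\<in>Poly_Mapping.keys m. x i ^ Poly_Mapping.lookup m i)" if m: "m \<in> ?K" for m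
      proof -
        have "T x x x x x p m = prod_list (map x (I m))" if "p \<in> S" for p
        proof -
          have "T x x x x x p m = (\<Prod>k<5. x (I m ! p k))"
            by (simp add: T_def eval_nat_numeral)
          also have "\<dots> = (\<Prod>k<5. x (I m ! k))"
            using that by (intro prod.permute[symmetric, unfolded o_def]) (simp add: S_def)
          also have "\<dots> = prod_list (map x (I m))"
            using I(1)[OF m] by (simp add: prod.list_conv_set_nth lessThan_atLeast0)
          finally show ?thesis .
        qed
        moreover have "card S = fact 5" unfolding S_def by (rule card_permutations) simp_all
        ultimately show ?thesis by (simp add: I(3)[OF m] fact_numeral)
      qed
      then have "M x x x x x = 120 * eval_mpoly G x"
        by (simp add: M_def eval_mpoly_def sum_distrib_left mult_ac)
      moreover have "eval_mpoly G x \<noteq> 0"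
        using no_zero that unfolding has_nontrivial_zero_def nonzero_in_def by blast
      ultimately show ?thesis by simp
    qed
  qed
  then show thesis by (rule that)
qed

text \<open>The existence conjunct ensures that the \<open>LEAST\<close> in \<open>v5\<close> is a
  genuine minimum and not an unspecified value.\<close>

theorem theorem2:
  "(\<exists>v. forms_isotropic_above 5 v) \<and> v5 5 \<le> 4562911"
proof -
  have "forms_isotropic_above 5 4562911"
    unfolding forms_isotropic_above_def
  proof (intro allI impI)
    fix n and G :: "q5 mpoly"
    assume "4562911 < n" "is_form n 5 G"
    show "has_nontrivial_zero n G"
    proof (rule ccontr)
      assume "\<not> has_nontrivial_zero n G"
      then obtain M where "anisotropic_quintic n M" using \<open>is_form n 5 G\<close> polarisation by blast
      moreover have "solvable n 25 375 3125"
        using system_bound_value \<open>4562911 < n\<close> by (intro solvable_system) simp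
      ultimately show False using anisotropic_quintic.not_solvable by blast
    qed
  qed
  then show ?thesis unfolding v5_def by (auto intro: Least_le)
qed

end
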